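(* Let $G$ and $H$ be finitely generated groups with $\operatorname{Con}_{\mathrm t}(G)=\operatorname{Con}_{\mathrm t}(H)$. Let $\mathbf P(G)$ (resp. $\mathbf P(H)$) denote the collection of normal subgroups $N$ of $G$ (resp. of $H$) such that the quotient $G/N$ (resp. $H/N$) is polycyclic. Then $\mathbf P(G)$ and $\mathbf P(H)$ have the same cardinality. Furthermore, if $\mathbf P(G)$ is finite, then there is a bijection $\Psi:\mathbf P(G)\to\mathbf P(H)$ such that (1) for every $N$ and $M$ in $\mathbf P(G)$, $\Psi(N\cap M)=\Psi(N)\cap\Psi(M)$; (2) for each $N\in\mathbf P(G)$, $G/N\cong H/\Psi(N)$.
   Context: A configuration pair $(\mathfrak g,\mathcal E)$ of a finitely generated (discrete) group $G$ consists of an ordered generating set, i.e. a finite tuple $\mathfrak g=(g_1,\dots,g_n)$ of elements of $G$ whose entries generate $G$ as a group, and a finite partition $\mathcal E=\{E_1,\dots,E_m\}$ of $G$ with indexed blocks. A two-sided configuration corresponding to $(\mathfrak g,\mathcal E)$ is a $(2n+1)$-tuple $C=(c_0,c_1,\dots,c_{2n})$ with $c_i\in\{1,\dots,m\}$ for which there exists $x\in E_{c_0}$ such that $g_ix\in E_{c_i}$ and $xg_i\in E_{c_{i+n}}$ for each $i\in\{1,\dots,n\}$. The set of all of these is denoted $\operatorname{Con}_{\mathrm t}(\mathfrak g,\mathcal E)$. $\operatorname{Con}_{\mathrm t}(G)$ is the set of all sets $\operatorname{Con}_{\mathrm t}(\mathfrak g,\mathcal E)$, where $(\mathfrak g,\mathcal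 E)$ ranges over all configuration pairs of $G$. *)

theory Defs
  imports
    "HOL-Algebra.Elementary_Groups"
    "HOL-Library.Equipollence"
    "HOL-Library.Disjoint_Sets"
begin

definition fin_gen_group :: "('a, 'b) monoid_scheme \<Rightarrow> bool" where
  "fin_gen_group G \<longleftrightarrow>
     group G \<and> (\<exists>S. finite S \<and> S \<subseteq> carrier G \<and> generate G S = carrier G)"

text \<open>
  The generating tuple \<open>(g\<^sub>1, \<dots>, g\<^sub>n)\<close> and the indexed partition \<open>{E\<^sub>1, \<dots>, E\<^sub>m}\<close> are lists,
  so \<open>g\<^sub>i\<close> is \<open>gs ! (i - 1)\<close> and \<open>E\<^sub>j\<close> is \<open>Es ! (j - 1)\<close>.  The generating tuple may have repeated
  entries; the blocks are nonempty and listed without repetition.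
\<close>

definition config_pair :: "('a, 'b) monoid_scheme \<Rightarrow> 'a list \<Rightarrow> 'a set list \<Rightarrow> bool" where
  "config_pair G gs Es \<longleftrightarrow>
     set gs \<subseteq> carrier G \<and> generate G (set gs) = carrier G \<and>
     distinct Es \<and> partition_on (carrier G) (set Es)"

text \<open>
  A configuration \<open>(c\<^sub>0, \<dots>, c\<^sub>2\<^sub>n)\<close> is a list of block indices in \<open>{1..m}\<close>; its positions start
  at 0, as in the tuple.
\<close>

definition two_sided_config ::
    "('a, 'b) monoid_scheme \<Rightarrow> 'a list \<Rightarrow> 'a set list \<Rightarrow> nat list \<Rightarrow> bool" where
  "two_sided_config G gs Es C \<longleftrightarrow>
     length C = 2 * length gs + 1 \<and> set C \<subseteq> {1..length Es} \<and>
     (\<exists>x \<in> Es ! (C ! 0 - 1). \<forall>i \<in> {1..length gs}.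
        gs ! (i - 1) \<otimes>\<^bsub>G\<^esub> x \<in> Es ! (C ! i - 1) \<and>
        x \<otimes>\<^bsub>G\<^esub> gs ! (i - 1) \<in> Es ! (C ! (i + length gs) - 1))"

definition Con_t_pair ::
    "('a, 'b) monoid_scheme \<Rightarrow> 'a list \<Rightarrow> 'a set list \<Rightarrow> nat list set" where
  "Con_t_pair G gs Es = {C. two_sided_config G gs Es C}"

definition Con_t :: "('a, 'b) monoid_scheme \<Rightarrow> nat list set set" where
  "Con_t G = {Con_t_pair G gs Es | gs Es. config_pair G gs Es}"

text \<open>Existence of a finite subnormal series \<open>{\<one>} = K 0 \<lhd> \<dots> \<lhd> K n = G\<close> with cyclic factors.\<close>

definition polycyclic :: "('a, 'b) monoid_scheme \<Rightarrow> bool" where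
  "polycyclic G \<longleftrightarrow>
     group G \<and>
     (\<exists>(n::nat) (K :: nat \<Rightarrow> 'a set).
        K 0 = {\<one>\<^bsub>G\<^esub>} \<and> K n = carrier G \<and> (\<forall>i\<le>n. subgroup (K i) G) \<and>
        (\<forall>i<n. K i \<lhd> (G\<lparr>carrier := K (Suc i)\<rparr>) \<and>
                cyclic_group ((G\<lparr>carrier := K (Suc i)\<rparr>) Mod K i)))"

definition polycyclic_quot_subgroups :: "('a, 'b) monoid_scheme \<Rightarrow> 'a set set" where
  "polycyclic_quot_subgroups G = {N. N \<lhd> G \<and> polycyclic (G Mod N)}"

end

theory Submission
  imports Defs
begin

text \<open>
  Let \<open>Q = G/N\<close> be polycyclic.  Then \<open>Q\<close> is finitely presented, so there is a finite set \<open>T\<close> of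
  generators of \<open>G\<close> whose multiplication table modulo \<open>N\<close> presents \<open>Q\<close>.  Partition \<open>G\<close> so finely
  that the cosets \<open>t N\<close> with \<open>t \<in> T\<close>, the members of a polycyclic series, and finitely many unions
  of their cosets are unions of blocks.  A partition of \<open>H\<close> with the same configuration set
  yields a set \<open>A\<^sub>0 \<subseteq> H\<close> corresponding to \<open>N\<close>.  Comparing left and right translates shows that
  \<open>A\<^sub>0\<close> is invariant under conjugation, so its stabilizer \<open>L\<close> is normal in \<open>H\<close>.  The relations
  of \<open>Q\<close> hold in \<open>H/L\<close>, since they move \<open>A\<^sub>0\<close> through cosets \<open>t N\<close>, which gives an epimorphism
  \<open>Q \<rightarrow> H/L\<close>.  It is injective because an element outside \<open>N\<close> has a normal form along the series
  that visibly moves \<open>N\<close> off itself.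

  Since \<open>\<^bold>P(G)\<close> is closed under finite intersections, every finite subset of \<open>\<^bold>P(G)\<close> embeds into
  \<open>\<^bold>P(H)\<close> via the correspondence theorem for \<open>G/N \<cong> H/L\<close>, where \<open>N\<close> is its intersection, and
  conversely.  If \<open>\<^bold>P(G)\<close> is finite, take \<open>N = \<Inter> \<^bold>P(G)\<close>.  Otherwise both collections are
  infinite, and they are countable because each of their members is the normal closure of a
  finite set.
\<close>

subsection \<open>Polycyclic series relative to a subgroup\<close>

text \<open>States that \<open>B\<close> is normal in \<open>C\<close> with \<open>C / B\<close>
  cyclic, generated by the class of \<open>q\<close>, but in terms of elements of \<open>G\<close>
  only. Series, words and translates can then be handled without passing to cosets and their
  type.\<close>

locale cyclic_ext = group G for G (structure) +
  fixes B C :: "'a set" and q :: 'a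
  assumes subB: "subgroup B G" and subC: "subgroup C G" and BC: "B \<subseteq> C"
    and conj: "\<lbrakk>c \<in> C; b \<in> B\<rbrakk> \<Longrightarrow> c \<otimes> b \<otimes> inv c \<in> B"
    and qC: "q \<in> C"
    and gen: "c \<in> C \<Longrightarrow> \<exists>k::int. c \<otimes> q [^] k \<in> B"
begin

lemma C_carrier: "c \<in> C \<Longrightarrow> c \<in> carrier G"
  by (rule subgroup.mem_carrier[OF subC])

lemma B_carrier: "c \<in> B \<Longrightarrow> c \<in> carrier G"
  using BC C_carrier by blast

lemma qG [simp]: "q \<in> carrier G"
  using qC C_carrier by blast

lemma q_pow_C: "q [^] (k::int) \<in> C"
  by (rule subgroup_int_pow_closed[OF subC qC])

lemma B_mult: "a \<in> B \<Longrightarrow> b \<in> B \<Longrightarrow> a \<otimes> b \<in> B"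
  by (rule subgroup.m_closed[OF subB])

lemma C_mult: "a \<in> C \<Longrightarrow> b \<in> C \<Longrightarrow> a \<otimes> b \<in> C"
  by (rule subgroup.m_closed[OF subC])

lemma B_inv: "b \<in> B \<Longrightarrow> inv b \<in> B"
  by (rule subgroup.m_inv_closed[OF subB])

lemma C_inv: "b \<in> C \<Longrightarrow> inv b \<in> C"
  by (rule subgroup.m_inv_closed[OF subC])

lemma conj': "\<lbrakk>c \<in> C; b \<in> B\<rbrakk> \<Longrightarrow> inv c \<otimes> b \<otimes> c \<in> B"
  using conj[of "inv c" b] C_inv C_carrier by simp

lemma commute_mod:
  assumes "a \<in> C" "c \<in> C" "a \<otimes> c \<in> B"
  shows "c \<otimes> a \<in> B"
proof -
  have "inv a \<otimes> (a \<otimes> c) \<otimes> a \<in> B" using conj' assms by blast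
  moreover have "inv a \<otimes> (a \<otimes> c) \<otimes> a = c \<otimes> a"
    using assms C_carrier by (simp add: m_assoc flip: m_assoc[of "inv a" a])
  ultimately show ?thesis by simp
qed

text \<open>Call \<open>k\<close> a level of \<open>c\<close> when
  \<open>c \<otimes> q [^] k \<in> B\<close>, so that \<open>c\<close> is congruent to
  \<open>q [^] (- k)\<close> modulo \<open>B\<close>. Levels add because conjugating the second
  witness by \<open>c\<close> keeps it in \<open>B\<close>.\<close>

lemma level_mult:
  assumes "c \<in> C" "c' \<in> C" "c \<otimes> q [^] (k::int) \<in> B" "c' \<otimes> q [^] (k'::int) \<in> B"
  shows "c \<otimes> c' \<otimes> q [^] (k + k') \<in> B"
proof -
  have cc: "c \<in> carrier G" "c' \<in> carrier G" using assms C_carrier by auto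
  have "(c \<otimes> (c' \<otimes> q [^] k') \<otimes> inv c) \<otimes> (c \<otimes> q [^] k) \<in> B"
    using assms conj B_mult by blast
  moreover have "(c \<otimes> (c' \<otimes> q [^] k') \<otimes> inv c) \<otimes> (c \<otimes> q [^] k) = c \<otimes> c' \<otimes> (q [^] k' \<otimes> q [^] k)"
    using cc by (simp add: m_assoc inv_solve_left')
  ultimately show ?thesis using cc by (simp add: int_pow_mult[symmetric] add.commute)
qed

lemma level_inv:
  assumes "c \<in> C" "c \<otimes> q [^] (k::int) \<in> B"
  shows "inv c \<otimes> q [^] (- k) \<in> B"
proof -
  have "q [^] k \<otimes> c \<in> B" using commute_mod assms q_pow_C by blast
  then have "inv (q [^] k \<otimes> c) \<in> B" by (rule B_inv)
  then show ?thesis using assms C_carrier by (simp add: inv_mult_group int_pow_neg)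
qed

lemma level_pow:
  assumes "c \<in> C" "c \<otimes> q [^] (k::int) \<in> B"
  shows "c [^] (j::int) \<otimes> q [^] (j * k) \<in> B"
proof -
  have nat: "c [^] (int n) \<otimes> q [^] (int n * k) \<in> B" for n
  proof (induction n)
    case 0
    then show ?case using subgroup.one_closed[OF subB] by simp
  next
    case (Suc n)
    have "c [^] int n \<in> C" using assms subgroup_int_pow_closed[OF subC] by blast
    then have "c [^] int n \<otimes> c \<otimes> q [^] (int n * k + k) \<in> B"
      using level_mult Suc assms by blast
    then show ?case
      using assms C_carrier int_pow_mult[of c "int n" 1]
      by (simp add: distrib_right add.commute[of 1])
  qed
  show ?thesis
  proof (cases "j \<ge> 0")
    case True
    then show ?thesis using nat[of "nat j"] by simp
  next
    case False
    have "c [^] int (nat (-j)) \<in> C" using assms subgroup_int_pow_closed[OF subC] by blast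
    from level_inv[OF this nat] show ?thesis
      using False assms C_carrier by (simp add: int_pow_neg)
  qed
qed

end

text \<open>Chains of cyclic extensions with an arbitrary lower end. For normal \<open>N\<close>, a
  chain from \<open>N\<close> to the whole group expresses inside \<open>G\<close> that the quotient
  by \<open>N\<close> is polycyclic.\<close>

inductive pc_series :: "('a, 'b) monoid_scheme \<Rightarrow> 'a set \<Rightarrow> 'a set \<Rightarrow> bool" for G A where
  base: "subgroup A G \<Longrightarrow> pc_series G A A"
| step: "pc_series G A B \<Longrightarrow> cyclic_ext G B C q \<Longrightarrow> pc_series G A C"

lemma pc_series_subgroup:
  assumes "pc_series G A B"
  shows "subgroup A G" "subgroup B G" "A \<subseteq> B"
  using assms by (induction) (auto dest: cyclic_ext.subC cyclic_ext.BC)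

lemma pc_series_trans:
  assumes "pc_series G B C" "pc_series G A B"
  shows "pc_series G A C"
  using assms by (induction) (auto intro: pc_series.step)

section \<open>Series under intersections, images and preimages\<close>

lemma (in group) cyclic_extI:
  assumes "subgroup B G" "subgroup C G" "B \<subseteq> C" "q \<in> C"
    and "\<And>c b. \<lbrakk>c \<in> C; b \<in> B\<rbrakk> \<Longrightarrow> c \<otimes> b \<otimes> inv c \<in> B"
    and "\<And>c. c \<in> C \<Longrightarrow> \<exists>k::int. c \<otimes> q [^] k \<in> B"
  shows "cyclic_ext G B C q"
  by (simp add: assms cyclic_ext_def cyclic_ext_axioms_def is_group)

text \<open>The levels of the elements of \<open>C \<inter> D\<close> form a subgroup of the
  integers. This subgroup is cyclic, and an element whose level generates it also generates
  \<open>C \<inter> D\<close> modulo \<open>B \<inter> D\<close>.\<close>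

lemma cyclic_ext_Int:
  fixes G (structure)
  assumes "cyclic_ext G B C q" "subgroup D G"
  shows "\<exists>q'. cyclic_ext G (B \<inter> D) (C \<inter> D) q'"
proof -
  interpret cyclic_ext G B C q by fact
  have sBD: "subgroup (B \<inter> D) G" and sCD: "subgroup (C \<inter> D) G"
    using subgroups_Inter_pair subB subC assms(2) by auto
  have conjD: "c \<otimes> b \<otimes> inv c \<in> B \<inter> D" if "c \<in> C \<inter> D" "b \<in> B \<inter> D" for c b
    using that conj assms(2) by (auto intro: subgroup.m_closed subgroup.m_inv_closed)
  define I where "I = {k::int. \<exists>c \<in> C \<inter> D. c \<otimes> q [^] k \<in> B}"
  have I_diff: "k - j * l \<in> I" if kl: "k \<in> I" "l \<in> I" for k l j
  proof -
    obtain c c' where c: "c \<in> C \<inter> D" "c \<otimes> q [^] k \<in> B" "c' \<in> C \<inter> D" "c' \<otimes> q [^] l \<in> B"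
      using kl unfolding I_def by blast
    have m: "c' [^] (-j) \<in> C \<inter> D" using c subgroup_int_pow_closed[OF sCD] by blast
    have "c \<otimes> c' [^] (-j) \<otimes> q [^] (k + (-j) * l) \<in> B"
      using level_mult[of c "c' [^] (-j)"] level_pow[of c' l "-j"] c m by blast
    then show ?thesis unfolding I_def
      using m c subgroup.m_closed[OF sCD] by fastforce
  qed
  have ext: "cyclic_ext G (B \<inter> D) (C \<inter> D) q'"
    if q': "q' \<in> C \<inter> D" "\<And>c. c \<in> C \<inter> D \<Longrightarrow> \<exists>k::int. c \<otimes> q' [^] k \<in> B" for q'
  proof (rule cyclic_extI)
    fix c assume c: "c \<in> C \<inter> D"
    then obtain k :: int where "c \<otimes> q' [^] k \<in> B" using q' by blast
    moreover have "c \<otimes> q' [^] k \<in> C \<inter> D"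
      using c q' subgroup.m_closed[OF sCD] subgroup_int_pow_closed[OF sCD] by blast
    ultimately show "\<exists>k::int. c \<otimes> q' [^] k \<in> B \<inter> D" by blast
  qed (use sBD sCD BC conjD q' in auto)
  show ?thesis
  proof (cases "\<exists>k\<in>I. k \<noteq> 0")
    case True
    then obtain k0 where k0: "k0 \<in> I" "k0 \<noteq> 0" by blast
    have "0 - 1 * k0 \<in> I"
      using I_diff[OF k0(1) k0(1), of 1] I_diff[of "k0 - 1*k0" k0 1] k0 by simp
    with k0 have ex: "\<exists>n::nat. n > 0 \<and> int n \<in> I"
      by (cases "k0 > 0") (auto intro: exI[of _ "nat k0"] exI[of _ "nat (- k0)"])
    \<comment> \<open>The positive generator of \<open>I\<close>; by Euclidean division it divides
      every level of an element of \<open>C \<inter> D\<close>.\<close>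
    define d where "d = (LEAST n::nat. n > 0 \<and> int n \<in> I)"
    have d: "d > 0" "int d \<in> I" using LeastI_ex[OF ex] unfolding d_def by auto
    have min: "\<not> (n > 0 \<and> int n \<in> I)" if "n < d" for n
      using not_less_Least that unfolding d_def by blast
    obtain c0 where c0: "c0 \<in> C \<inter> D" "c0 \<otimes> q [^] int d \<in> B"
      using d unfolding I_def by blast
    have "\<exists>k::int. c \<otimes> c0 [^] k \<in> B" if c: "c \<in> C \<inter> D" for c
    proof -
      obtain k :: int where k: "c \<otimes> q [^] k \<in> B" using gen c by blast
      then have "k \<in> I" using c unfolding I_def by blast
      then have "k - (k div int d) * int d \<in> I" using I_diff d by blast
      then have "k mod int d \<in> I" by (simp add: minus_div_mult_eq_mod)
      moreover have "0 \<le> k mod int d" "k mod int d < int d" using d by auto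
      ultimately have "k mod int d = 0"
        using min[of "nat (k mod int d)"] by (auto simp: nat_less_iff)
      then have kd: "k + (- (k div int d)) * int d = 0"
        by (metis add.commute add.right_inverse minus_mult_left mult_div_mod_eq mult.commute add.right_neutral)
      have m: "c0 [^] (- (k div int d)) \<in> C \<inter> D" using c0 subgroup_int_pow_closed[OF sCD] by blast
      \<comment> \<open>The power of \<open>c0\<close> is chosen so that the product has level 0,
        which means that it lies in \<open>B\<close> itself.\<close>
      have "c \<otimes> c0 [^] (- (k div int d)) \<otimes> q [^] (k + (- (k div int d)) * int d) \<in> B"
        using level_mult[of c "c0 [^] (- (k div int d))"] level_pow[of c0 "int d" "- (k div int d)"] c c0 k m by blast
      then show ?thesis
        using kd c m C_carrier by (intro exI[of _ "- (k div int d)"]) auto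
    qed
    then show ?thesis using ext c0 by blast
  next
    case False
    \<comment> \<open>With 0 as the only level, \<open>C \<inter> D\<close> is contained in
      \<open>B\<close>, and the identity serves as generator.\<close>
    have "\<exists>k::int. c \<otimes> \<one> [^] k \<in> B" if c: "c \<in> C \<inter> D" for c
    proof -
      obtain k :: int where k: "c \<otimes> q [^] k \<in> B" using gen c by blast
      then have "k = 0" using c False unfolding I_def by blast
      then show ?thesis using k by auto
    qed
    then show ?thesis using ext[of \<one>] subgroup.one_closed[OF sCD] by blast
  qed
qed

lemma pc_series_Int:
  assumes "pc_series G A B" "group G" "subgroup D G"
  shows "pc_series G (A \<inter> D) (B \<inter> D)"
  using assms
proof (induction)
  case base
  then show ?case by (simp add: pc_series.base group.subgroups_Inter_pair)
next
  case (step B C q)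
  then show ?case using cyclic_ext_Int[OF step.hyps(2)] by (meson pc_series.step)
qed

lemma (in group_hom) cyclic_ext_image:
  assumes "cyclic_ext G B C q"
  shows "cyclic_ext H (h ` B) (h ` C) (h q)"
proof -
  interpret E: cyclic_ext G B C q by fact
  show ?thesis
  proof (rule H.cyclic_extI)
    fix c b assume "c \<in> h ` C" "b \<in> h ` B"
    then obtain c' b' where cb: "c' \<in> C" "b' \<in> B" "c = h c'" "b = h b'" by auto
    then have "c \<otimes>\<^bsub>H\<^esub> b \<otimes>\<^bsub>H\<^esub> inv\<^bsub>H\<^esub> c = h (c' \<otimes> b' \<otimes> inv c')"
      using E.C_carrier E.B_carrier by simp
    then show "c \<otimes>\<^bsub>H\<^esub> b \<otimes>\<^bsub>H\<^esub> inv\<^bsub>H\<^esub> c \<in> h ` B" using cb E.conj by blast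
  next
    fix c assume "c \<in> h ` C"
    then obtain c' where c: "c' \<in> C" "c = h c'" by auto
    then obtain k :: int where "c' \<otimes> q [^] k \<in> B" using E.gen by blast
    then have "h (c' \<otimes> q [^] k) \<in> h ` B" by blast
    then show "\<exists>k::int. c \<otimes>\<^bsub>H\<^esub> h q [^]\<^bsub>H\<^esub> k \<in> h ` B"
      using c E.C_carrier by (auto simp: hom_int_pow)
  qed (use E.subB E.subC E.BC E.qC subgroup_img_is_subgroup in auto)
qed

lemma (in group_hom) pc_series_image:
  assumes "pc_series G A B"
  shows "pc_series H (h ` A) (h ` B)"
  using assms
  by (induction) (auto intro: pc_series.intros cyclic_ext_image subgroup_img_is_subgroup)

lemma (in group_hom) subgroup_preimage:
  assumes "subgroup B H"
  shows "subgroup {x \<in> carrier G. h x \<in> B} G"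
  by (unfold_locales)
    (use subgroup.m_closed[OF assms] subgroup.one_closed[OF assms] subgroup.m_inv_closed[OF assms]
      in auto)

lemma (in group_hom) cyclic_ext_preimage:
  assumes "cyclic_ext H B C q" "h ` carrier G = carrier H"
  shows "\<exists>q'. cyclic_ext G {x \<in> carrier G. h x \<in> B} {x \<in> carrier G. h x \<in> C} q'"
proof -
  interpret E: cyclic_ext H B C q by fact
  obtain q' where q': "q' \<in> carrier G" "h q' = q" using assms(2) E.qG by (metis imageE)
  have "cyclic_ext G {x \<in> carrier G. h x \<in> B} {x \<in> carrier G. h x \<in> C} q'"
  proof (rule G.cyclic_extI)
    fix c assume c: "c \<in> {x \<in> carrier G. h x \<in> C}"
    then obtain k :: int where "h c \<otimes>\<^bsub>H\<^esub> q [^]\<^bsub>H\<^esub> k \<in> B" using E.gen by blast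
    then show "\<exists>k::int. c \<otimes> q' [^] k \<in> {x \<in> carrier G. h x \<in> B}"
      using c q' by (intro exI[of _ k]) (auto simp: hom_int_pow)
  qed (use subgroup_preimage E.subB E.subC E.BC E.qC E.conj q' in auto)
  then show ?thesis by blast
qed

lemma (in group_hom) pc_series_preimage:
  assumes "pc_series H A B" "h ` carrier G = carrier H"
  shows "pc_series G {x \<in> carrier G. h x \<in> A} {x \<in> carrier G. h x \<in> B}"
  using assms
proof (induction)
  case base
  then show ?case by (simp add: pc_series.base subgroup_preimage)
next
  case (step B C q)
  then show ?case using cyclic_ext_preimage by (meson pc_series.step)
qed

section \<open>Polycyclic quotients as series in the group\<close>

lemma (in group) cyclic_ext_iff:
  assumes B: "subgroup B G" and C: "subgroup C G"
  shows "(\<exists>q. cyclic_ext G B C q) \<longleftrightarrow>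
    B \<lhd> G\<lparr>carrier := C\<rparr> \<and> cyclic_group (G\<lparr>carrier := C\<rparr> Mod B)"
proof
  assume "\<exists>q. cyclic_ext G B C q"
  then obtain q where "cyclic_ext G B C q" by blast
  then interpret E: cyclic_ext G B C q .
  interpret GC: group "G\<lparr>carrier := C\<rparr>" using C subgroup_imp_group by blast
  have n: "B \<lhd> G\<lparr>carrier := C\<rparr>"
    by (rule GC.normal_invI)
      (use E.conj E.BC B C subgroup_incl in auto)
  then interpret n: normal B "G\<lparr>carrier := C\<rparr>" .
  interpret Q: group "G\<lparr>carrier := C\<rparr> Mod B" by (rule n.factorgroup_is_group)
  have "X \<in> range (\<lambda>k::int. (B #> q) [^]\<^bsub>G\<lparr>carrier := C\<rparr> Mod B\<^esub> k)"
    if X: "X \<in> carrier (G\<lparr>carrier := C\<rparr> Mod B)" for X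
  proof -
    obtain c where c: "c \<in> C" "X = B #> c" using X by (auto simp: carrier_FactGroup)
    obtain k :: int where k: "c \<otimes> q [^] k \<in> B" using E.gen c by blast
    \<comment> \<open>A level is the negative of an exponent, hence the change of sign between
      \<open>gen\<close> and the powers of the coset of \<open>q\<close>.\<close>
    have "B #> c = B #> q [^] (- k)"
    proof -
      have "c \<otimes> inv (q [^] (-k)) \<in> B" using k by (simp add: int_pow_neg)
      then have "c \<in> B #> q [^] (-k)"
        using subgroup.rcos_module_rev[OF B is_group] c E.C_carrier by simp
      then show ?thesis using repr_independence[OF _ _ B] by simp
    qed
    also have "\<dots> = (B #> q) [^]\<^bsub>G\<lparr>carrier := C\<rparr> Mod B\<^esub> (-k)"
      using n.FactGroup_int_pow[of q "-k"] E.qC int_pow_consistent[OF C E.qC] by simp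
    finally show ?thesis using c by blast
  qed
  moreover have "B #> q \<in> carrier (G\<lparr>carrier := C\<rparr> Mod B)"
    using E.qC by (auto simp: carrier_FactGroup)
  ultimately have "cyclic_group (G\<lparr>carrier := C\<rparr> Mod B)"
    unfolding Q.cyclic_group using Q.int_pow_closed by blast
  with n show "B \<lhd> G\<lparr>carrier := C\<rparr> \<and> cyclic_group (G\<lparr>carrier := C\<rparr> Mod B)" by simp
next
  assume r: "B \<lhd> G\<lparr>carrier := C\<rparr> \<and> cyclic_group (G\<lparr>carrier := C\<rparr> Mod B)"
  then interpret n: normal B "G\<lparr>carrier := C\<rparr>" by blast
  interpret Q: group "G\<lparr>carrier := C\<rparr> Mod B" by (rule n.factorgroup_is_group)
  obtain X where X: "X \<in> carrier (G\<lparr>carrier := C\<rparr> Mod B)"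
    "carrier (G\<lparr>carrier := C\<rparr> Mod B) = range (\<lambda>k::int. X [^]\<^bsub>G\<lparr>carrier := C\<rparr> Mod B\<^esub> k)"
    using r Q.cyclic_group by blast
  obtain q where q: "q \<in> C" "X = B #> q" using X(1) by (auto simp: carrier_FactGroup)
  have BC: "B \<subseteq> C" using n.subset by simp
  have "cyclic_ext G B C q"
  proof (rule cyclic_extI)
    show "c \<otimes> b \<otimes> inv c \<in> B" if "c \<in> C" "b \<in> B" for c b
      using that n.inv_op_closed2[of c b] C by simp
    fix c assume c: "c \<in> C"
    then have "B #> c \<in> carrier (G\<lparr>carrier := C\<rparr> Mod B)" by (auto simp: carrier_FactGroup)
    then obtain k :: int where "B #> c = X [^]\<^bsub>G\<lparr>carrier := C\<rparr> Mod B\<^esub> k" using X(2) by blast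
    also have "\<dots> = B #> q [^] k"
      using n.FactGroup_int_pow[of q k] q int_pow_consistent[OF C q(1)] by simp
    finally have e: "B #> c = B #> q [^] k" .
    have G: "c \<in> carrier G" "q \<in> carrier G" using c q subgroup.mem_carrier[OF C] by auto
    then have "c \<in> B #> q [^] k" using e rcos_self[OF G(1) B] by simp
    then have "c \<otimes> inv (q [^] k) \<in> B"
      using subgroup.rcos_module_imp[OF B is_group] G by blast
    then show "\<exists>k::int. c \<otimes> q [^] k \<in> B" using G by (intro exI[of _ "- k"]) (simp add: int_pow_neg)
  qed (use B C BC q in auto)
  then show "\<exists>q. cyclic_ext G B C q" by blast
qed

lemma polycyclic_iff_pc_series:
  fixes G (structure)
  shows "polycyclic G \<longleftrightarrow> group G \<and> pc_series G {\<one>\<^bsub>G\<^esub>} (carrier G)"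
proof
  assume p: "polycyclic G"
  then interpret group G unfolding polycyclic_def by blast
  obtain n :: nat and K where K: "K 0 = {\<one>}" "K n = carrier G" "\<forall>i\<le>n. subgroup (K i) G"
    "\<forall>i<n. K i \<lhd> G\<lparr>carrier := K (Suc i)\<rparr> \<and> cyclic_group (G\<lparr>carrier := K (Suc i)\<rparr> Mod K i)"
    using p unfolding polycyclic_def by blast
  have "i \<le> n \<Longrightarrow> pc_series G (K 0) (K i)" for i
  proof (induction i)
    case 0
    then show ?case using K(3) by (simp add: pc_series.base)
  next
    case (Suc i)
    then have "\<exists>q. cyclic_ext G (K i) (K (Suc i)) q"
      using K(3,4) cyclic_ext_iff[of "K i" "K (Suc i)"] by simp
    then show ?case using Suc by (auto intro: pc_series.step)
  qed
  then show "group G \<and> pc_series G {\<one>} (carrier G)" using K by (metis is_group order_refl)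
next
  assume r: "group G \<and> pc_series G {\<one>\<^bsub>G\<^esub>} (carrier G)"
  then interpret group G by blast
  have "\<exists>(n::nat) K. K 0 = A \<and> K n = B \<and> (\<forall>i\<le>n. subgroup (K i) G) \<and>
        (\<forall>i<n. K i \<lhd> (G\<lparr>carrier := K (Suc i)\<rparr>) \<and>
                cyclic_group ((G\<lparr>carrier := K (Suc i)\<rparr>) Mod K i))"
    if "pc_series G A B" for A B
    using that
  proof (induction)
    case base
    then show ?case by (intro exI[of _ 0] exI[of _ "\<lambda>_. A"]) simp
  next
    case (step B C q)
    then obtain n :: nat and K where K: "K 0 = A" "K n = B" "\<forall>i\<le>n. subgroup (K i) G"
      "\<forall>i<n. K i \<lhd> G\<lparr>carrier := K (Suc i)\<rparr> \<and> cyclic_group (G\<lparr>carrier := K (Suc i)\<rparr> Mod K i)"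
      by blast
    have BC: "subgroup B G" "subgroup C G"
      using cyclic_ext.subB[OF step(2)] cyclic_ext.subC[OF step(2)] by auto
    have "B \<lhd> G\<lparr>carrier := C\<rparr> \<and> cyclic_group (G\<lparr>carrier := C\<rparr> Mod B)"
      using cyclic_ext_iff[OF BC] step(2) by blast
    \<comment> \<open>The new top goes to index \<open>Suc n\<close>, the first entry on which
      nothing has been required so far.\<close>
    then show ?case using K BC
      by (intro exI[of _ "Suc n"] exI[of _ "K(Suc n := C)"]) (auto simp: less_Suc_eq le_Suc_eq)
  qed
  then show "polycyclic G" using r unfolding polycyclic_def by blast
qed

lemma (in normal) FactGroup_group_hom: "group_hom G (G Mod H) (\<lambda>x. H #> x)"
  using factorgroup_is_group r_coset_hom_Mod by (simp add: group_hom_def group_hom_axioms_def is_group)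

lemma (in normal) rcos_eq_self_iff: "x \<in> carrier G \<Longrightarrow> H #> x = H \<longleftrightarrow> x \<in> H"
  using coset_join1 coset_join2 is_subgroup subset by blast

text \<open>Preimages under the projection turn a series of the quotient into a series above
  \<open>H\<close>, and images lead back. The lower ends match because \<open>H\<close> is the
  preimage of the identity coset.\<close>

lemma (in normal) polycyclic_Mod_iff:
  "polycyclic (G Mod H) \<longleftrightarrow> pc_series G H (carrier G)"
proof -
  interpret p: group_hom G "G Mod H" "\<lambda>x. H #> x" by (rule FactGroup_group_hom)
  have surj: "(\<lambda>x. H #> x) ` carrier G = carrier (G Mod H)" by (simp add: carrier_FactGroup)
  show ?thesis
  proof
    assume "polycyclic (G Mod H)"
    then have "pc_series (G Mod H) {H} (carrier (G Mod H))"
      by (simp add: polycyclic_iff_pc_series)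
    from p.pc_series_preimage[OF this surj]
    have "pc_series G {x \<in> carrier G. H #> x \<in> {H}} {x \<in> carrier G. H #> x \<in> carrier (G Mod H)}" .
    moreover have "{x \<in> carrier G. H #> x \<in> {H}} = H"
      using rcos_eq_self_iff subset by auto
    moreover have "{x \<in> carrier G. H #> x \<in> carrier (G Mod H)} = carrier G" by auto
    ultimately show "pc_series G H (carrier G)" by simp
  next
    assume "pc_series G H (carrier G)"
    then have "pc_series (G Mod H) ((\<lambda>x. H #> x) ` H) (carrier (G Mod H))"
      using p.pc_series_image surj by metis
    moreover have "(\<lambda>x. H #> x) ` H = {H}"
    proof -
      have "(\<lambda>x. H #> x) ` H = (\<lambda>x. H) ` H"
        by (rule image_cong) (auto simp: rcos_const)
      then show ?thesis using subgroup.one_closed[OF is_subgroup] by (metis image_constant)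
    qed
    ultimately show "polycyclic (G Mod H)"
      by (simp add: polycyclic_iff_pc_series factorgroup_is_group)
  qed
qed

lemma polycyclic_iso:
  fixes G (structure)
  assumes "polycyclic G" "G \<cong> H" "group H"
  shows "polycyclic H"
proof -
  obtain h where h: "h \<in> iso G H" using assms(2) unfolding is_iso_def by blast
  interpret group G using assms(1) polycyclic_iff_pc_series by blast
  interpret group_hom G H h
    using h assms(3) by (simp add: group_hom_def group_hom_axioms_def is_group iso_imp_homomorphism)
  have "pc_series H (h ` {\<one>}) (h ` carrier G)"
    using pc_series_image assms(1) polycyclic_iff_pc_series by blast
  then show ?thesis using h assms(3) by (simp add: polycyclic_iff_pc_series Group.iso_iff)
qed

lemma (in group) polycyclic_quot_subgroups_iff:
  "N \<in> polycyclic_quot_subgroups G \<longleftrightarrow> N \<lhd> G \<and> pc_series G N (carrier G)"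
  using normal.polycyclic_Mod_iff unfolding polycyclic_quot_subgroups_def by blast

text \<open>Intersecting a series from \<open>M\<close> to the whole group with \<open>N\<close>
  gives a series from \<open>N \<inter> M\<close> to \<open>N\<close>, which the series above
  \<open>N\<close> continues.\<close>

lemma (in group) polycyclic_quot_subgroups_Int:
  assumes "N \<in> polycyclic_quot_subgroups G" "M \<in> polycyclic_quot_subgroups G"
  shows "N \<inter> M \<in> polycyclic_quot_subgroups G"
proof -
  have "pc_series G (M \<inter> N) (carrier G \<inter> N)"
    using assms pc_series_Int is_group normal_imp_subgroup polycyclic_quot_subgroups_iff by blast
  moreover have "carrier G \<inter> N = N"
    using assms normal_imp_subgroup subgroup.subset polycyclic_quot_subgroups_iff by blast
  ultimately have "pc_series G (N \<inter> M) N" by (simp add: Int_commute)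
  then show ?thesis
    using assms normal_subgroup_intersect pc_series_trans polycyclic_quot_subgroups_iff by blast
qed

lemma (in group) carrier_in_polycyclic_quot_subgroups: "carrier G \<in> polycyclic_quot_subgroups G"
  using pc_series.base subgroup_self normal_invI by (auto simp: polycyclic_quot_subgroups_iff)

subsection \<open>Finite presentations modulo a subgroup\<close>

text \<open>
  \<open>presents\<close> is a word-free form of ``\<open>B / N\<close> is finitely presented'': the finite partial
  multiplication table of \<open>S\<close> modulo \<open>N\<close> is a complete set of relations.  The type argument is
  the element type of the target groups, over which a HOL formula cannot quantify.
\<close>

definition partial_hom ::
    "('a, 'b) monoid_scheme \<Rightarrow> 'a set \<Rightarrow> 'a set \<Rightarrow> ('k, 'l) monoid_scheme \<Rightarrow> ('a \<Rightarrow> 'k) \<Rightarrow> bool" where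
  "partial_hom G N S K \<phi> \<longleftrightarrow> \<phi> \<in> S \<rightarrow> carrier K \<and>
     (\<forall>a\<in>S. \<forall>b\<in>S. \<forall>c\<in>S. a \<otimes>\<^bsub>G\<^esub> b \<otimes>\<^bsub>G\<^esub> inv\<^bsub>G\<^esub> c \<in> N \<longrightarrow> \<phi> a \<otimes>\<^bsub>K\<^esub> \<phi> b = \<phi> c)"

definition presents ::
    "'k itself \<Rightarrow> ('a, 'b) monoid_scheme \<Rightarrow> 'a set \<Rightarrow> 'a set \<Rightarrow> 'a set \<Rightarrow> bool" where
  "presents _ G N B S \<longleftrightarrow>
     finite S \<and> S \<subseteq> B \<and> \<one>\<^bsub>G\<^esub> \<in> S \<and> subgroup N G \<and> subgroup B G \<and> generate G (S \<union> N) = B \<and>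
     (\<forall>(K::'k monoid) \<phi>. group K \<longrightarrow> partial_hom G N S K \<phi> \<longrightarrow>
        (\<exists>\<psi> \<in> hom (G\<lparr>carrier := B\<rparr>) K. (\<forall>s\<in>S. \<psi> s = \<phi> s) \<and> (\<forall>n\<in>N. \<psi> n = \<one>\<^bsub>K\<^esub>)))"

lemma partial_hom_subset: "partial_hom G N S' K \<phi> \<Longrightarrow> S \<subseteq> S' \<Longrightarrow> partial_hom G N S K \<phi>"
  unfolding partial_hom_def by blast

lemma (in group) partial_hom_mult:
  assumes "partial_hom G N S K \<phi>" "subgroup N G" "a \<in> S" "b \<in> S" "a \<otimes> b \<in> S" "S \<subseteq> carrier G"
  shows "\<phi> (a \<otimes> b) = \<phi> a \<otimes>\<^bsub>K\<^esub> \<phi> b"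
proof -
  have "a \<otimes> b \<otimes> inv (a \<otimes> b) \<in> N"
    using assms subgroup.one_closed[OF assms(2)] by (simp add: subset_iff)
  then show ?thesis using assms unfolding partial_hom_def by metis
qed

text \<open>If the enlarged table forces the value at \<open>x\<close>, the homomorphism supplied by
  the old table already has that value, so no new extension has to be built. This is the tool for
  enlarging presenting sets.\<close>

lemma (in group) presents_insert:
  assumes p: "presents TYPE('k) G N B S" and x: "x \<in> B"
    and det: "\<And>(K::'k monoid) \<phi> \<psi>. \<lbrakk>group K; partial_hom G N (insert x S) K \<phi>;
        \<psi> \<in> hom (G\<lparr>carrier := B\<rparr>) K; \<forall>s\<in>S. \<psi> s = \<phi> s; \<forall>n\<in>N. \<psi> n = \<one>\<^bsub>K\<^esub>\<rbrakk> \<Longrightarrow> \<psi> x = \<phi> x"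
  shows "presents TYPE('k) G N B (insert x S)"
proof -
  have B: "subgroup B G" "generate G (S \<union> N) = B" "S \<union> N \<subseteq> carrier G"
    using p subgroup.subset unfolding presents_def by blast+
  then have xG: "x \<in> carrier G" using x subgroup.mem_carrier by fast
  have "generate G (insert x S \<union> N) \<subseteq> B"
    using B x generate.incl[of _ "S \<union> N" G] by (intro generate_subgroup_incl) auto
  moreover have "B \<subseteq> generate G (insert x S \<union> N)"
    using B(2) mono_generate[of "S \<union> N" "insert x S \<union> N"] by auto
  ultimately have g: "generate G (insert x S \<union> N) = B" by blast
  have "\<exists>\<psi> \<in> hom (G\<lparr>carrier := B\<rparr>) K. (\<forall>s\<in>insert x S. \<psi> s = \<phi> s) \<and> (\<forall>n\<in>N. \<psi> n = \<one>\<^bsub>K\<^esub>)"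
    if K: "group K" "partial_hom G N (insert x S) K \<phi>" for K :: "'k monoid" and \<phi>
  proof -
    have "partial_hom G N S K \<phi>" using partial_hom_subset[OF K(2)] by blast
    then obtain \<psi> where "\<psi> \<in> hom (G\<lparr>carrier := B\<rparr>) K" "\<forall>s\<in>S. \<psi> s = \<phi> s" "\<forall>n\<in>N. \<psi> n = \<one>\<^bsub>K\<^esub>"
      using p K(1) unfolding presents_def by blast
    then show ?thesis using det[OF K] by blast
  qed
  then show ?thesis using p x g unfolding presents_def by blast
qed

text \<open>The table then contains the relation \<open>x \<otimes> \<one> = \<one>\<close> modulo
  \<open>N\<close>, and cancellation makes \<open>\<phi> x\<close> trivial.\<close>

lemma (in group) presents_insert_kernel:
  assumes p: "presents TYPE('k) G N B S" and x: "x \<in> N"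
  shows "presents TYPE('k) G N B (insert x S)"
proof (rule presents_insert[OF p])
  show "x \<in> B"
    using p x generate.incl[of x "S \<union> N" G] unfolding presents_def by blast
  fix K :: "'k monoid" and \<phi> \<psi>
  assume K: "group K" "partial_hom G N (insert x S) K \<phi>"
    "\<forall>s\<in>S. \<psi> s = \<phi> s" "\<forall>n\<in>N. \<psi> n = \<one>\<^bsub>K\<^esub>"
  interpret K: group K by fact
  have o: "\<one> \<in> S" "\<one> \<in> N" "x \<in> carrier G"
    using p x subgroup.one_closed subgroup.mem_carrier unfolding presents_def by fast+
  have "x \<otimes> \<one> \<otimes> inv \<one> \<in> N" using o x by simp
  then have "\<phi> x \<otimes>\<^bsub>K\<^esub> \<phi> \<one> = \<phi> \<one>" "\<phi> x \<in> carrier K"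
    using K(2) o unfolding partial_hom_def by auto
  then have "\<phi> x = \<one>\<^bsub>K\<^esub>" using K o by (metis K.l_one K.one_closed K.r_one)
  then show "\<psi> x = \<phi> x" using K x by simp
qed

text \<open>Following a word for \<open>x\<close>, each intermediate value is added in turn. Its
  image is forced by one product in the table, so \<open>presents_insert\<close> applies.\<close>

lemma (in group) presents_extend1:
  assumes "x \<in> generate G (S \<union> N)" "presents TYPE('k) G N B S"
  shows "\<exists>S'. S \<subseteq> S' \<and> x \<in> S' \<and> presents TYPE('k) G N B S'"
proof -
  \<comment> \<open>The induction runs over all presenting sets above \<open>S\<close>, so that in
    the product case the second factor can be added on top of the set that already holds the
    first.\<close>
  have "\<exists>S''. S' \<subseteq> S'' \<and> x \<in> S'' \<and> presents TYPE('k) G N B S''"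
    if "S \<subseteq> S'" "presents TYPE('k) G N B S'" for S'
    using assms(1) that
  proof (induction x arbitrary: S')
    case one
    then show ?case unfolding presents_def by blast
  next
    case (incl x)
    show ?case
    proof (cases "x \<in> S'")
      case False
      then show ?thesis using incl presents_insert_kernel[OF incl(3)] by blast
    qed (use incl in blast)
  next
    case (inv x)
    obtain T where T: "S' \<subseteq> T" "x \<in> T" "presents TYPE('k) G N B T"
    proof (cases "x \<in> S'")
      case False
      then show ?thesis using inv that presents_insert_kernel[OF inv(3)] by blast
    qed (use inv that in blast)
    have B: "subgroup B G" "T \<subseteq> B" "subgroup N G" "\<one> \<in> T" using T unfolding presents_def by blast+
    have TG: "T \<subseteq> carrier G" using B subgroup.subset by blast
    have xB: "inv x \<in> B" using T B subgroup.m_inv_closed[OF B(1)] by blast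
    have "presents TYPE('k) G N B (insert (inv x) T)"
    proof (rule presents_insert[OF T(3) xB])
      fix K :: "'k monoid" and \<phi> \<psi>
      assume K: "group K" "partial_hom G N (insert (inv x) T) K \<phi>"
        "\<psi> \<in> hom (G\<lparr>carrier := B\<rparr>) K" "\<forall>s\<in>T. \<psi> s = \<phi> s"
      interpret K: group K by fact
      \<comment> \<open>The table contains \<open>inv x\<close>, \<open>x\<close> and their product
        \<open>\<one>\<close>; this single relation determines the value at
        \<open>inv x\<close>.\<close>
      have "\<phi> (inv x \<otimes> x) = \<phi> (inv x) \<otimes>\<^bsub>K\<^esub> \<phi> x"
        by (rule partial_hom_mult[OF K(2)]) (use T B TG in auto)
      moreover have "\<psi> (inv x \<otimes> x) = \<psi> (inv x) \<otimes>\<^bsub>K\<^esub> \<psi> x"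
        using K(3) xB T B unfolding hom_def by auto
      moreover have "inv x \<otimes> x = \<one>" using T TG by auto
      moreover have "\<phi> (inv x) \<in> carrier K" "\<phi> x \<in> carrier K"
        using K(2) T unfolding partial_hom_def by auto
      moreover have "\<psi> (inv x) \<in> carrier K" using K(3) xB unfolding hom_def by auto
      ultimately show "\<psi> (inv x) = \<phi> (inv x)" using K(4) T B by (metis K.right_cancel)
    qed
    then show ?case using T by blast
  next
    case (eng x y)
    obtain S1 where S1: "S' \<subseteq> S1" "x \<in> S1" "presents TYPE('k) G N B S1"
      using eng.IH(1) eng.prems by blast
    obtain T where T: "S1 \<subseteq> T" "y \<in> T" "presents TYPE('k) G N B T"
      using eng.IH(2)[of S1] S1 eng.prems by blast
    have B: "subgroup B G" "T \<subseteq> B" "subgroup N G" "x \<in> T" using T S1 unfolding presents_def by blast+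
    have TG: "T \<subseteq> carrier G" using B subgroup.subset by blast
    have xB: "x \<otimes> y \<in> B" using T B subgroup.m_closed[OF B(1)] by blast
    have "presents TYPE('k) G N B (insert (x \<otimes> y) T)"
    proof (rule presents_insert[OF T(3) xB])
      fix K :: "'k monoid" and \<phi> \<psi>
      assume K: "group K" "partial_hom G N (insert (x \<otimes> y) T) K \<phi>"
        "\<psi> \<in> hom (G\<lparr>carrier := B\<rparr>) K" "\<forall>s\<in>T. \<psi> s = \<phi> s"
      have "\<phi> (x \<otimes> y) = \<phi> x \<otimes>\<^bsub>K\<^esub> \<phi> y"
        by (rule partial_hom_mult[OF K(2)]) (use T B TG in auto)
      moreover have "\<psi> (x \<otimes> y) = \<psi> x \<otimes>\<^bsub>K\<^esub> \<psi> y"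
        using K(3) subsetD[OF B(2) T(2)] subsetD[OF B(2,4)] unfolding hom_def by auto
      ultimately show "\<psi> (x \<otimes> y) = \<phi> (x \<otimes> y)" using K(4) T B by simp
    qed
    moreover have "S' \<subseteq> insert (x \<otimes> y) T" using T(1) S1(1) by auto
    ultimately show ?case by (meson insertI1)
  qed
  then show ?thesis using assms(2) by blast
qed

lemma (in group) presents_extend:
  assumes "finite F" "F \<subseteq> B" "presents TYPE('k) G N B S"
  shows "\<exists>S'. S \<subseteq> S' \<and> F \<subseteq> S' \<and> presents TYPE('k) G N B S'"
  using assms
proof (induction)
  case (insert x F)
  then obtain S' where S': "S \<subseteq> S'" "F \<subseteq> S'" "presents TYPE('k) G N B S'" by auto
  then have "x \<in> generate G (S' \<union> N)" using insert.prems unfolding presents_def by auto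
  then show ?case using presents_extend1[OF _ S'(3), of x] S' by blast
qed blast

section \<open>Presentations of cyclic extensions\<close>

context cyclic_ext
begin

lemma generate_ext:
  assumes "generate G X = B" "X \<subseteq> Y" "q \<in> Y" "Y \<subseteq> C"
  shows "generate G Y = C"
proof
  show "generate G Y \<subseteq> C" using assms subC by (intro generate_subgroup_incl) auto
  have sg: "subgroup (generate G Y) G" using assms C_carrier by (intro generate_is_subgroup) blast
  show "C \<subseteq> generate G Y"
  proof
    fix c assume c: "c \<in> C"
    obtain k :: int where "c \<otimes> q [^] k \<in> B" using gen c by blast
    then have "c \<otimes> q [^] k \<in> generate G Y" using assms(1) mono_generate[OF assms(2)] by blast
    moreover have "q [^] (- k) \<in> generate G Y"
      using subgroup_int_pow_closed[OF sg] generate.incl[of q Y G] assms by blast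
    ultimately have "c \<otimes> q [^] k \<otimes> q [^] (- k) \<in> generate G Y" by (rule generate.eng)
    then show "c \<in> generate G Y" using C_carrier[OF c] by (simp add: m_assoc flip: int_pow_mult)
  qed
qed

lemma q_conj: "b \<in> B \<Longrightarrow> q [^] (k::int) \<otimes> b \<otimes> q [^] (- k) \<in> B"
  using conj[OF q_pow_C] by (simp add: int_pow_neg)

text \<open>Here \<open>r\<close> is the order of \<open>q\<close> modulo \<open>B\<close>, with 0
  standing for infinite order: in that case the divisibility says that only the zeroth power of
  \<open>q\<close> lies in \<open>B\<close>.\<close>

lemma exponent:
  obtains r :: nat where "q [^] r \<in> B" "\<And>k::int. q [^] k \<in> B \<Longrightarrow> int r dvd k"
proof (cases "\<exists>n::nat. n > 0 \<and> q [^] n \<in> B")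
  case True
  define r where "r = (LEAST n::nat. n > 0 \<and> q [^] n \<in> B)"
  have r: "r > 0" "q [^] r \<in> B" using LeastI_ex[OF True] unfolding r_def by auto
  have min: "\<not> (n > 0 \<and> q [^] n \<in> B)" if "n < r" for n :: nat
    using not_less_Least that unfolding r_def by blast
  have "int r dvd k" if k: "q [^] k \<in> B" for k :: int
  proof -
    have "(q [^] int r) [^] (- (k div int r)) \<in> B"
      using subgroup_int_pow_closed[OF subB] r by (simp add: int_pow_int)
    then have "q [^] (int r * - (k div int r)) \<in> B" by (simp only: int_pow_pow[OF qG])
    then have "q [^] k \<otimes> q [^] (int r * - (k div int r)) \<in> B" using k B_mult by blast
    then have "q [^] (k + int r * - (k div int r)) \<in> B" by (simp only: int_pow_mult[OF qG])
    moreover have "k + int r * - (k div int r) = k mod int r"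
      by (simp add: minus_mult_div_eq_mod)
    ultimately have "q [^] (nat (k mod int r)) \<in> B"
      using r by (simp add: pow_nat)
    then have "k mod int r = 0"
      using min[of "nat (k mod int r)"] r pos_mod_sign[of "int r" k] pos_mod_bound[of "int r" k]
      by (auto simp: nat_less_iff le_less)
    then show ?thesis by auto
  qed
  then show ?thesis using that r by blast
next
  case False
  have "k = 0" if k: "q [^] k \<in> B" for k :: int
  proof (rule ccontr)
    assume "k \<noteq> 0"
    moreover have "q [^] (- k) \<in> B" using B_inv[OF k] by (simp add: int_pow_neg)
    ultimately have "q [^] nat \<bar>k\<bar> \<in> B"
      using k by (cases "k > 0") (auto simp: pow_nat abs_if)
    moreover have "nat \<bar>k\<bar> > 0" using \<open>k \<noteq> 0\<close> by simp
    ultimately show False using False by blast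
  qed
  then show ?thesis using that[of 0] subgroup.one_closed[OF subB] by auto
qed

text \<open>The extension sends \<open>c\<close> to \<open>\<phi> (c \<otimes> q [^] k)\<close>
  times the power \<open>- k\<close> of \<open>h\<close>, for any level \<open>k\<close> of
  \<open>c\<close>. Independence of the level comes from \<open>pow\<close>, multiplicativity from
  \<open>comm\<close>.\<close>

lemma hom_extend:
  fixes K :: "('k, 'l) monoid_scheme"
  assumes K: "group K" and \<phi>: "\<phi> \<in> hom (G\<lparr>carrier := B\<rparr>) K" and h: "h \<in> carrier K"
    and pow: "\<And>k::int. q [^] k \<in> B \<Longrightarrow> \<phi> (q [^] k) = h [^]\<^bsub>K\<^esub> k"
    and comm: "\<And>b. b \<in> B \<Longrightarrow> h \<otimes>\<^bsub>K\<^esub> \<phi> b = \<phi> (q \<otimes> b \<otimes> inv q) \<otimes>\<^bsub>K\<^esub> h"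
  obtains \<psi> where "\<psi> \<in> hom (G\<lparr>carrier := C\<rparr>) K" "\<And>b. b \<in> B \<Longrightarrow> \<psi> b = \<phi> b" "\<psi> q = h"
proof -
  interpret K: group K by fact
  have \<phi>m: "\<phi> (a \<otimes> b) = \<phi> a \<otimes>\<^bsub>K\<^esub> \<phi> b" if "a \<in> B" "b \<in> B" for a b
    using \<phi> that unfolding hom_def by auto
  have \<phi>K: "\<phi> a \<in> carrier K" if "a \<in> B" for a
    using \<phi> that unfolding hom_def by auto
  \<comment> \<open>The rule \<open>comm\<close> is iterated for natural exponents first. Negative
    exponents follow by applying the result to the conjugate of \<open>b\<close>.\<close>
  have commn: "h [^]\<^bsub>K\<^esub> int n \<otimes>\<^bsub>K\<^esub> \<phi> b = \<phi> (q [^] int n \<otimes> b \<otimes> q [^] (- int n)) \<otimes>\<^bsub>K\<^esub> h [^]\<^bsub>K\<^esub> int n"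
    if "b \<in> B" for n b
    using that
  proof (induction n arbitrary: b)
    case 0
    then show ?case using B_carrier \<phi>K by simp
  next
    case (Suc n)
    let ?b = "q \<otimes> b \<otimes> inv q"
    have b: "?b \<in> B" using conj qC Suc by blast
    have "h [^]\<^bsub>K\<^esub> int (Suc n) \<otimes>\<^bsub>K\<^esub> \<phi> b = h [^]\<^bsub>K\<^esub> int n \<otimes>\<^bsub>K\<^esub> (h \<otimes>\<^bsub>K\<^esub> \<phi> b)"
      using h \<phi>K Suc.prems by (simp only: int_pow_int K.nat_pow_Suc K.m_assoc K.nat_pow_closed)
    also have "\<dots> = h [^]\<^bsub>K\<^esub> int n \<otimes>\<^bsub>K\<^esub> \<phi> ?b \<otimes>\<^bsub>K\<^esub> h"
      using comm[OF Suc.prems] h \<phi>K b by (simp add: K.m_assoc)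
    also have "\<dots> = \<phi> (q [^] int n \<otimes> ?b \<otimes> q [^] (- int n)) \<otimes>\<^bsub>K\<^esub> h [^]\<^bsub>K\<^esub> int n \<otimes>\<^bsub>K\<^esub> h"
      using Suc.IH[OF b] by simp
    also have "q [^] int n \<otimes> ?b \<otimes> q [^] (- int n) = q [^] int (Suc n) \<otimes> b \<otimes> q [^] (- int (Suc n))"
      using Suc.prems B_carrier
      by (simp only: int_pow_neg_int[OF qG] int_pow_int nat_pow_Suc)
        (simp add: inv_mult_group m_assoc)
    also have "\<phi> \<dots> \<otimes>\<^bsub>K\<^esub> h [^]\<^bsub>K\<^esub> int n \<otimes>\<^bsub>K\<^esub> h = \<phi> \<dots> \<otimes>\<^bsub>K\<^esub> h [^]\<^bsub>K\<^esub> int (Suc n)"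
      using h \<phi>K[OF q_conj[OF Suc.prems, of "int (Suc n)"]]
      by (simp only: int_pow_int K.nat_pow_Suc K.m_assoc K.nat_pow_closed)
    finally show ?case .
  qed
  have commk: "h [^]\<^bsub>K\<^esub> k \<otimes>\<^bsub>K\<^esub> \<phi> b = \<phi> (q [^] k \<otimes> b \<otimes> q [^] (- k)) \<otimes>\<^bsub>K\<^esub> h [^]\<^bsub>K\<^esub> k"
    if b: "b \<in> B" for k :: int and b
  proof (cases "k \<ge> 0")
    case True
    then show ?thesis using commn[OF b, of "nat k"] by simp
  next
    case False
    let ?n = "nat (- k)"
    let ?b = "q [^] k \<otimes> b \<otimes> q [^] (- k)"
    have b': "?b \<in> B" using q_conj b by blast
    have n: "int ?n = - k" using False by simp
    have "q [^] (- k) \<otimes> ?b \<otimes> q [^] (- (- k)) = b"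
      using B_carrier[OF b] by (simp add: int_pow_neg m_assoc flip: m_assoc[of "inv (q [^] k)" "q [^] k"])
    then have "h [^]\<^bsub>K\<^esub> (- k) \<otimes>\<^bsub>K\<^esub> \<phi> ?b = \<phi> b \<otimes>\<^bsub>K\<^esub> h [^]\<^bsub>K\<^esub> (- k)"
      using commn[OF b', of ?n] by (simp only: n)
    then have "h [^]\<^bsub>K\<^esub> k \<otimes>\<^bsub>K\<^esub> (h [^]\<^bsub>K\<^esub> (- k) \<otimes>\<^bsub>K\<^esub> \<phi> ?b) \<otimes>\<^bsub>K\<^esub> h [^]\<^bsub>K\<^esub> k =
        h [^]\<^bsub>K\<^esub> k \<otimes>\<^bsub>K\<^esub> (\<phi> b \<otimes>\<^bsub>K\<^esub> h [^]\<^bsub>K\<^esub> (- k)) \<otimes>\<^bsub>K\<^esub> h [^]\<^bsub>K\<^esub> k"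
      by simp
    then show ?thesis
      using h \<phi>K[OF b] \<phi>K[OF b']
      by (simp add: K.int_pow_neg K.m_assoc flip: K.m_assoc[of "h [^]\<^bsub>K\<^esub> k" "inv\<^bsub>K\<^esub> (h [^]\<^bsub>K\<^esub> k)"])
  qed
  \<comment> \<open>The level is picked arbitrarily here; the next fact shows that every level gives
    the same value.\<close>
  define \<psi> where "\<psi> c = (let k = SOME k::int. c \<otimes> q [^] k \<in> B in \<phi> (c \<otimes> q [^] k) \<otimes>\<^bsub>K\<^esub> h [^]\<^bsub>K\<^esub> (- k))" for c
  have \<psi>: "\<psi> c = \<phi> (c \<otimes> q [^] k) \<otimes>\<^bsub>K\<^esub> h [^]\<^bsub>K\<^esub> (- k)" if c: "c \<in> C" "c \<otimes> q [^] k \<in> B" for c and k :: int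
  proof -
    define l where "l = (SOME k::int. c \<otimes> q [^] k \<in> B)"
    have l: "c \<otimes> q [^] l \<in> B" unfolding l_def by (rule someI_ex) (use gen c in blast)
    have cG: "c \<in> carrier G" using c C_carrier by blast
    have e: "c \<otimes> q [^] l = (c \<otimes> q [^] k) \<otimes> q [^] (l - k)"
      using cG by (simp add: m_assoc flip: int_pow_mult)
    have "q [^] (l - k) = inv (c \<otimes> q [^] k) \<otimes> (c \<otimes> q [^] l)"
      unfolding e by (metis B_carrier c(2) inv_solve_left int_pow_closed m_closed qG)
    then have lk: "q [^] (l - k) \<in> B" using l c(2) B_mult B_inv by metis
    have "\<psi> c = \<phi> (c \<otimes> q [^] l) \<otimes>\<^bsub>K\<^esub> h [^]\<^bsub>K\<^esub> (- l)" unfolding \<psi>_def l_def Let_def by simp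
    also have "\<dots> = \<phi> (c \<otimes> q [^] k) \<otimes>\<^bsub>K\<^esub> h [^]\<^bsub>K\<^esub> (l - k) \<otimes>\<^bsub>K\<^esub> h [^]\<^bsub>K\<^esub> (- l)"
      unfolding e using \<phi>m[OF c(2) lk] pow[OF lk] by simp
    also have "\<dots> = \<phi> (c \<otimes> q [^] k) \<otimes>\<^bsub>K\<^esub> h [^]\<^bsub>K\<^esub> (- k)"
      using \<phi>K[OF c(2)] h by (simp add: K.m_assoc flip: K.int_pow_mult)
    finally show ?thesis .
  qed
  have "\<psi> \<in> hom (G\<lparr>carrier := C\<rparr>) K"
  proof (rule homI)
    fix c assume "c \<in> carrier (G\<lparr>carrier := C\<rparr>)"
    then obtain k :: int where "c \<in> C" "c \<otimes> q [^] k \<in> B" using gen by auto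
    then show "\<psi> c \<in> carrier K" using \<psi> \<phi>K h by simp
  next
    fix c c' assume "c \<in> carrier (G\<lparr>carrier := C\<rparr>)" "c' \<in> carrier (G\<lparr>carrier := C\<rparr>)"
    then have cc: "c \<in> C" "c' \<in> C" by auto
    then obtain k k' :: int where k: "c \<otimes> q [^] k \<in> B" "c' \<otimes> q [^] k' \<in> B" using gen by meson
    let ?b = "c \<otimes> q [^] k" and ?b' = "c' \<otimes> q [^] k'"
    \<comment> \<open>Writing \<open>c\<close> as \<open>?b \<otimes> q [^] (- k)\<close>, this is
      what \<open>?b'\<close> becomes when the power of \<open>q\<close> is moved to its
      right.\<close>
    let ?d = "q [^] (- k) \<otimes> ?b' \<otimes> q [^] (- (- k))"
    have d: "?d \<in> B" using q_conj k by blast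
    have cG: "c \<in> carrier G" "c' \<in> carrier G" using cc C_carrier by auto
    have e: "c \<otimes> c' \<otimes> q [^] (k + k') = ?b \<otimes> ?d"
      using cG by (simp add: int_pow_neg int_pow_mult add.commute[of k] m_assoc
          flip: m_assoc[of "q [^] k" "inv (q [^] k)"])
    have "\<psi> (c \<otimes> c') = \<phi> (?b \<otimes> ?d) \<otimes>\<^bsub>K\<^esub> h [^]\<^bsub>K\<^esub> (- (k + k'))"
      using \<psi>[OF C_mult[OF cc] level_mult[OF cc k]] e by simp
    also have "\<dots> = \<phi> ?b \<otimes>\<^bsub>K\<^esub> (\<phi> ?d \<otimes>\<^bsub>K\<^esub> h [^]\<^bsub>K\<^esub> (- k)) \<otimes>\<^bsub>K\<^esub> h [^]\<^bsub>K\<^esub> (- k')"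
      using \<phi>m[OF k(1) d] \<phi>K[OF k(1)] \<phi>K[OF d] h
      by (simp add: K.m_assoc flip: K.int_pow_mult)
    also have "\<phi> ?d \<otimes>\<^bsub>K\<^esub> h [^]\<^bsub>K\<^esub> (- k) = h [^]\<^bsub>K\<^esub> (- k) \<otimes>\<^bsub>K\<^esub> \<phi> ?b'"
      using commk[OF k(2), of "- k"] by simp
    also have "\<phi> ?b \<otimes>\<^bsub>K\<^esub> \<dots> \<otimes>\<^bsub>K\<^esub> h [^]\<^bsub>K\<^esub> (- k') = \<psi> c \<otimes>\<^bsub>K\<^esub> \<psi> c'"
      using \<psi>[OF cc(1) k(1)] \<psi>[OF cc(2) k(2)] \<phi>K[OF k(1)] \<phi>K[OF k(2)] h by (simp add: K.m_assoc)
    finally show "\<psi> (c \<otimes>\<^bsub>G\<lparr>carrier := C\<rparr>\<^esub> c') = \<psi> c \<otimes>\<^bsub>K\<^esub> \<psi> c'" by simp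
  qed
  moreover have "\<psi> b = \<phi> b" if "b \<in> B" for b
    using \<psi>[of b 0] that BC B_carrier[OF that] \<phi>K[OF that] by auto
  moreover have "\<psi> q = h"
  proof -
    have o: "q \<otimes> q [^] (-1::int) = \<one>" by (simp add: int_pow_neg)
    have "\<psi> q = \<phi> \<one> \<otimes>\<^bsub>K\<^esub> h [^]\<^bsub>K\<^esub> (1::int)"
      using \<psi>[of q "-1"] qC o subgroup.one_closed[OF subB] by simp
    moreover have "\<phi> \<one> = \<one>\<^bsub>K\<^esub>" using pow[of 0] subgroup.one_closed[OF subB] by simp
    ultimately show ?thesis using h by simp
  qed
  ultimately show ?thesis using that by blast
qed

text \<open>A cyclic extension of a finitely presented group is finitely presented. Besides the
  relations of \<open>B\<close>, the table has to record the power of \<open>q\<close> that falls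
  into \<open>B\<close> and the action of \<open>q\<close> on the generators; these are the two
  hypotheses of \<open>hom_extend\<close>.\<close>

lemma presents_step:
  assumes p: "presents TYPE('k) G N B S" and qN: "\<And>n. n \<in> N \<Longrightarrow> q \<otimes> n \<otimes> inv q \<in> N"
  shows "\<exists>S'. S \<subseteq> S' \<and> presents TYPE('k) G N C S'"
proof -
  have S: "finite S" "S \<subseteq> B" "subgroup N G" "generate G (S \<union> N) = B" "N \<subseteq> B" "\<one> \<in> S"
    using p generate.incl[of _ "S \<union> N" G] unfolding presents_def by blast+
  obtain r :: nat where r: "q [^] r \<in> B" "\<And>k::int. q [^] k \<in> B \<Longrightarrow> int r dvd k"
    using exponent by metis
  \<comment> \<open>The elements of \<open>B\<close> occurring in the new relations, namely
    \<open>q [^] r\<close> and the conjugates of generators, are first made part of the table of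
    \<open>B\<close>.\<close>
  have "\<exists>S1. S \<subseteq> S1 \<and> insert (q [^] r) ((\<lambda>s. q \<otimes> s \<otimes> inv q) ` S) \<subseteq> S1 \<and> presents TYPE('k) G N B S1"
    by (rule presents_extend) (use S p r conj[OF qC] in auto)
  then obtain S1 where S1: "S \<subseteq> S1" "q [^] r \<in> S1" "\<And>s. s \<in> S \<Longrightarrow> q \<otimes> s \<otimes> inv q \<in> S1"
    "presents TYPE('k) G N B S1" by blast
  have S1B: "finite S1" "S1 \<subseteq> B" using S1 unfolding presents_def by blast+
  \<comment> \<open>The bound \<open>Suc r\<close> guarantees that \<open>q\<close> itself is
    included even when \<open>r = 0\<close>. The products \<open>q \<otimes> s\<close> are the
    intermediate values needed to express conjugation.\<close>
  define S' where "S' = S1 \<union> (\<lambda>i::nat. q [^] i) ` {..Suc r} \<union> (\<lambda>s. q \<otimes> s) ` S"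
  have qnC: "q [^] (n::nat) \<in> C" for n using q_pow_C[of "int n"] by (simp add: int_pow_int)
  have S'C: "S' \<subseteq> C" using S1B BC S qnC qC C_mult unfolding S'_def by auto
  then have S'G: "S' \<subseteq> carrier G" using C_carrier by blast
  have q1: "q \<in> S'" unfolding S'_def by (auto intro!: image_eqI[of _ _ 1])
  have "presents TYPE('k) G N C S'"
    unfolding presents_def
  proof (intro conjI allI impI)
    show "finite S'" using S1B S unfolding S'_def by auto
    show "S' \<subseteq> C" by (rule S'C)
    show "\<one> \<in> S'" using S S1 unfolding S'_def by auto
    show "subgroup N G" by (rule S)
    show "subgroup C G" by (rule subC)
    show "generate G (S' \<union> N) = C"
      by (rule generate_ext[OF S(4)]) (use S S1 q1 S'C BC in \<open>auto simp: S'_def\<close>)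
    fix K :: "'k monoid" and \<phi>
    assume K: "group K" and \<phi>: "partial_hom G N S' K \<phi>"
    interpret K: group K by fact
    have \<phi>K: "\<phi> s \<in> carrier K" if "s \<in> S'" for s using \<phi> that unfolding partial_hom_def by auto
    have "partial_hom G N S1 K \<phi>" using partial_hom_subset[OF \<phi>] unfolding S'_def by blast
    then obtain \<phi>B where \<phi>B: "\<phi>B \<in> hom (G\<lparr>carrier := B\<rparr>) K" "\<forall>s\<in>S1. \<phi>B s = \<phi> s" "\<forall>n\<in>N. \<phi>B n = \<one>\<^bsub>K\<^esub>"
      using S1(4) K unfolding presents_def by blast
    interpret B: group_hom "G\<lparr>carrier := B\<rparr>" K \<phi>B
      using \<phi>B(1) K subgroup_imp_group[OF subB] by (simp add: group_hom_def group_hom_axioms_def)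
    define h where "h = \<phi> q"
    have h: "h \<in> carrier K" using \<phi>K q1 unfolding h_def by blast
    have \<phi>pow: "\<phi> (q [^] i) = h [^]\<^bsub>K\<^esub> i" if "i \<le> Suc r" for i :: nat
      using that
    proof (induction i)
      case 0
      have "\<phi> \<one> = \<phi>B \<one>" using \<phi>B S S1 by auto
      then show ?case using B.hom_one by simp
    next
      case (Suc i)
      have "\<phi> (q [^] i \<otimes> q) = \<phi> (q [^] i) \<otimes>\<^bsub>K\<^esub> \<phi> q"
        by (rule partial_hom_mult[OF \<phi> S(3) _ q1 _ S'G])
          (use Suc.prems in \<open>auto simp: S'_def intro!: image_eqI[of _ _ "Suc i"]\<close>)
      then show ?case using Suc h_def by simp
    qed
    \<comment> \<open>By the choice of \<open>r\<close>, a power of \<open>q\<close> in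
      \<open>B\<close> is a power of \<open>q [^] r\<close>, and the value there is known from the
      table.\<close>
    have pow: "\<phi>B (q [^] k) = h [^]\<^bsub>K\<^esub> k" if k: "q [^] k \<in> B" for k :: int
    proof -
      obtain j where j: "k = int r * j" using r(2)[OF k] by blast
      have "q [^] k = (q [^] int r) [^] j" using int_pow_pow[OF qG] j by simp
      also have "\<dots> = (q [^] r) [^]\<^bsub>G\<lparr>carrier := B\<rparr>\<^esub> j"
        using int_pow_consistent[OF subB r(1)] by (simp add: int_pow_int)
      also have "\<phi>B \<dots> = \<phi>B (q [^] r) [^]\<^bsub>K\<^esub> j"
        using B.hom_int_pow[of "q [^] r" j] r by simp
      also have "\<phi>B (q [^] r) = h [^]\<^bsub>K\<^esub> int r"
        using \<phi>B(2) S1(2) \<phi>pow[of r] by (simp add: int_pow_int)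
      also have "\<dots> [^]\<^bsub>K\<^esub> j = h [^]\<^bsub>K\<^esub> k" using K.int_pow_pow[OF h] j by simp
      finally show ?thesis .
    qed
    have comm: "h \<otimes>\<^bsub>K\<^esub> \<phi>B b = \<phi>B (q \<otimes> b \<otimes> inv q) \<otimes>\<^bsub>K\<^esub> h" if "b \<in> B" for b
    proof -
      have \<phi>BK: "\<phi>B b \<in> carrier K" if "b \<in> B" for b using B.hom_closed that by simp
      have \<phi>Bm: "\<phi>B (a \<otimes> b) = \<phi>B a \<otimes>\<^bsub>K\<^esub> \<phi>B b" if "a \<in> B" "b \<in> B" for a b
        using B.hom_mult that by simp
      have cj: "q \<otimes> b \<otimes> inv q \<in> B" if "b \<in> B" for b using conj[OF qC that] .
      have dist: "q \<otimes> (a \<otimes> b) \<otimes> inv q = (q \<otimes> a \<otimes> inv q) \<otimes> (q \<otimes> b \<otimes> inv q)"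
        if "a \<in> B" "b \<in> B" for a b
        using that B_carrier by (simp add: m_assoc flip: m_assoc[of "inv q" q])
      \<comment> \<open>The elements obeying the commutation rule form a subgroup. It remains to
        check \<open>S\<close>, where the rule is read off the table, and \<open>N\<close>, where
        both sides equal \<open>h\<close>.\<close>
      define E where "E = {b \<in> B. h \<otimes>\<^bsub>K\<^esub> \<phi>B b = \<phi>B (q \<otimes> b \<otimes> inv q) \<otimes>\<^bsub>K\<^esub> h}"
      have "subgroup E G"
      proof
        show "E \<subseteq> carrier G" using B_carrier unfolding E_def by blast
        show "\<one> \<in> E" using B.hom_one h subgroup.one_closed[OF subB] unfolding E_def by simp
        fix a assume a: "a \<in> E"
        have aB: "a \<in> B" "inv a \<in> B" using a B_inv unfolding E_def by auto
        have i: "\<phi>B (inv b) = inv\<^bsub>K\<^esub> \<phi>B b" if "b \<in> B" for b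
          using B.hom_inv[of b] that subB by simp
        have "q \<otimes> inv a \<otimes> inv q = inv (q \<otimes> a \<otimes> inv q)"
          using B_carrier[OF aB(1)] by (simp add: inv_mult_group m_assoc)
        then have "\<phi>B (q \<otimes> inv a \<otimes> inv q) = inv\<^bsub>K\<^esub> \<phi>B (q \<otimes> a \<otimes> inv q)"
          using i[OF cj[OF aB(1)]] by simp
        moreover have "\<phi>B (q \<otimes> a \<otimes> inv q) = h \<otimes>\<^bsub>K\<^esub> \<phi>B a \<otimes>\<^bsub>K\<^esub> inv\<^bsub>K\<^esub> h"
          using a h \<phi>BK[OF aB(1)] \<phi>BK[OF cj[OF aB(1)]] unfolding E_def
          by (simp add: K.inv_solve_right)
        ultimately have "h \<otimes>\<^bsub>K\<^esub> \<phi>B (inv a) = \<phi>B (q \<otimes> inv a \<otimes> inv q) \<otimes>\<^bsub>K\<^esub> h"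
          using i[OF aB(1)] h \<phi>BK[OF aB(1)] by (simp add: K.inv_mult_group K.m_assoc)
        then show "inv a \<in> E" using aB unfolding E_def by simp
        fix b assume b: "b \<in> E"
        have bB: "b \<in> B" using b unfolding E_def by simp
        have "h \<otimes>\<^bsub>K\<^esub> \<phi>B (a \<otimes> b) = (h \<otimes>\<^bsub>K\<^esub> \<phi>B a) \<otimes>\<^bsub>K\<^esub> \<phi>B b"
          using \<phi>Bm aB bB h \<phi>BK by (simp add: K.m_assoc)
        also have "\<dots> = \<phi>B (q \<otimes> a \<otimes> inv q) \<otimes>\<^bsub>K\<^esub> (h \<otimes>\<^bsub>K\<^esub> \<phi>B b)"
          using a h \<phi>BK aB bB cj unfolding E_def by (simp add: K.m_assoc)
        also have "\<dots> = \<phi>B (q \<otimes> (a \<otimes> b) \<otimes> inv q) \<otimes>\<^bsub>K\<^esub> h"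
          using b h \<phi>BK aB bB cj dist \<phi>Bm unfolding E_def by (simp add: K.m_assoc)
        finally show "a \<otimes> b \<in> E" using B_mult aB bB unfolding E_def by simp
      qed
      moreover have "S \<union> N \<subseteq> E"
      proof
        fix s assume s: "s \<in> S \<union> N"
        then have sB: "s \<in> B" using S by blast
        show "s \<in> E"
        proof (cases "s \<in> S")
          case True
          \<comment> \<open>The table holds two factorizations of \<open>q \<otimes> s\<close>: as
            \<open>q\<close> times \<open>s\<close>, and as the conjugate of \<open>s\<close> times
            \<open>q\<close>. Comparing them gives the rule for \<open>s\<close>.\<close>
          have "\<phi> (q \<otimes> s) = \<phi> q \<otimes>\<^bsub>K\<^esub> \<phi> s"
            by (rule partial_hom_mult[OF \<phi> S(3) q1 _ _ S'G])
              (use True S1 in \<open>auto simp: S'_def\<close>)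
          moreover have qs: "q \<otimes> s \<otimes> inv q \<otimes> q = q \<otimes> s" using B_carrier[OF sB] by (simp add: m_assoc)
          moreover have "\<phi> (q \<otimes> s \<otimes> inv q \<otimes> q) = \<phi> (q \<otimes> s \<otimes> inv q) \<otimes>\<^bsub>K\<^esub> \<phi> q"
            by (rule partial_hom_mult[OF \<phi> S(3) _ q1 _ S'G], unfold qs)
              (use True S1 in \<open>auto simp: S'_def\<close>)
          ultimately have "h \<otimes>\<^bsub>K\<^esub> \<phi> s = \<phi> (q \<otimes> s \<otimes> inv q) \<otimes>\<^bsub>K\<^esub> h"
            unfolding h_def by simp
          then show ?thesis using \<phi>B(2) S1 True sB unfolding E_def by auto
        next
          case False
          then have "s \<in> N" using s by blast
          then show ?thesis using \<phi>B(3) qN h sB unfolding E_def by simp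
        qed
      qed
      ultimately have "generate G (S \<union> N) \<subseteq> E" by (intro generate_subgroup_incl)
      then show ?thesis using that S(4) unfolding E_def by blast
    qed
    obtain \<psi> where \<psi>: "\<psi> \<in> hom (G\<lparr>carrier := C\<rparr>) K" "\<And>b. b \<in> B \<Longrightarrow> \<psi> b = \<phi>B b" "\<psi> q = h"
      using hom_extend[OF K \<phi>B(1) h pow comm] by blast
    have "\<psi> s = \<phi> s" if s: "s \<in> S'" for s
      using s unfolding S'_def
    proof (elim UnE imageE)
      assume "s \<in> S1"
      then show ?thesis using \<psi>(2) \<phi>B(2) S1B by auto
    next
      fix i assume i: "s = q [^] i" "i \<in> {..Suc r}"
      interpret C: group_hom "G\<lparr>carrier := C\<rparr>" K \<psi>
        using \<psi>(1) K subgroup_imp_group[OF subC] by (simp add: group_hom_def group_hom_axioms_def)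
      have "\<psi> (q [^] i) = \<psi> q [^]\<^bsub>K\<^esub> i"
        using C.hom_nat_pow[of q i] qC nat_pow_consistent[of q i C] by simp
      then show ?thesis using i \<psi>(3) \<phi>pow by simp
    next
      fix t assume t: "s = q \<otimes> t" "t \<in> S"
      have "\<phi> (q \<otimes> t) = \<phi> q \<otimes>\<^bsub>K\<^esub> \<phi> t"
        by (rule partial_hom_mult[OF \<phi> S(3) q1 _ _ S'G])
          (use t S1 in \<open>auto simp: S'_def\<close>)
      moreover have "\<psi> (q \<otimes> t) = \<psi> q \<otimes>\<^bsub>K\<^esub> \<psi> t"
        using \<psi>(1) qC t S BC unfolding hom_def by auto
      moreover have "\<psi> t = \<phi> t" using \<psi>(2)[of t] \<phi>B(2) subsetD[OF S(2) t(2)] subsetD[OF S1(1) t(2)] by simp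
      ultimately show ?thesis using \<psi>(3) t unfolding h_def by simp
    qed
    moreover have "\<psi> n = \<one>\<^bsub>K\<^esub>" if "n \<in> N" for n using \<psi>(2) \<phi>B(3) that S by auto
    ultimately show "\<exists>\<psi> \<in> hom (G\<lparr>carrier := C\<rparr>) K. (\<forall>s\<in>S'. \<psi> s = \<phi> s) \<and> (\<forall>n\<in>N. \<psi> n = \<one>\<^bsub>K\<^esub>)"
      using \<psi>(1) by blast
  qed
  moreover have "S \<subseteq> S'" using S1(1) unfolding S'_def by auto
  ultimately show ?thesis by (intro exI conjI)
qed

end

text \<open>Polycyclic groups are finitely presented: the series is climbed one cyclic factor at a
  time. The bottom needs just the relation \<open>\<one> \<otimes> \<one> = \<one>\<close>, and
  normality of \<open>N\<close> gives the conjugation hypothesis of every step.\<close>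

lemma (in group) pc_series_presents:
  assumes "N \<lhd> G" "pc_series G N B"
  shows "\<exists>S. presents TYPE('k) G N B S"
  using assms(2)
proof (induction)
  case base
  have "generate G ({\<one>} \<union> N) \<subseteq> N"
    using base subgroup.one_closed by (intro generate_subgroup_incl) auto
  then have "generate G ({\<one>} \<union> N) = N"
    using generate.incl[of _ "{\<one>} \<union> N" G] by blast
  moreover have "\<exists>\<psi> \<in> hom (G\<lparr>carrier := N\<rparr>) K.
      (\<forall>s\<in>{\<one>}. \<psi> s = \<phi> s) \<and> (\<forall>n\<in>N. \<psi> n = \<one>\<^bsub>K\<^esub>)"
    if "group K" "partial_hom G N {\<one>} K \<phi>" for K :: "'k monoid" and \<phi>
  proof -
    interpret K: group K by fact
    have "\<phi> \<one> \<otimes>\<^bsub>K\<^esub> \<phi> \<one> = \<phi> \<one>" "\<phi> \<one> \<in> carrier K"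
      using that subgroup.one_closed[OF base] unfolding partial_hom_def by auto
    then have "\<phi> \<one> = \<one>\<^bsub>K\<^esub>" by (metis K.l_one K.one_closed K.right_cancel)
    then show ?thesis by (intro bexI[of _ "\<lambda>_. \<one>\<^bsub>K\<^esub>"]) (auto simp: hom_def)
  qed
  ultimately have "presents TYPE('k) G N N {\<one>}"
    using base subgroup.one_closed[OF base] unfolding presents_def by blast
  then show ?case by blast
next
  case (step B C q)
  then obtain S where S: "presents TYPE('k) G N B S" by blast
  interpret E: cyclic_ext G B C q by (rule step)
  have "q \<otimes> n \<otimes> inv q \<in> N" if "n \<in> N" for n
    using normal_invE(2)[OF assms(1)] that by simp
  then show ?case using E.presents_step[OF S] by blast
qed

subsection \<open>Separation by finitely many sets\<close>

text \<open>
  \<open>reach G N S \<F> x V\<close>: a word in \<open>S\<close> with value \<open>x\<close> modulo \<open>N\<close> carries \<open>N\<close> into \<open>V\<close>, and this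
  is witnessed step by step by inclusions \<open>s U \<subseteq> V\<close> between members of \<open>\<F>\<close>, the only kind of
  information that a configuration set can see.
\<close>

inductive reach ::
    "('a, 'b) monoid_scheme \<Rightarrow> 'a set \<Rightarrow> 'a set \<Rightarrow> 'a set set \<Rightarrow> 'a \<Rightarrow> 'a set \<Rightarrow> bool"
  for G (structure) and N S \<F> where
  start: "U \<in> \<F> \<Longrightarrow> N \<subseteq> U \<Longrightarrow> reach G N S \<F> \<one> U"
| mult: "reach G N S \<F> x U \<Longrightarrow> s \<in> S \<Longrightarrow> V \<in> \<F> \<Longrightarrow> (\<And>y. y \<in> U \<Longrightarrow> s \<otimes> y \<in> V) \<Longrightarrow>
    reach G N S \<F> (s \<otimes> x) V"
| mult_inv: "reach G N S \<F> x U \<Longrightarrow> s \<in> S \<Longrightarrow> V \<in> \<F> \<Longrightarrow> (\<And>y. y \<in> U \<Longrightarrow> inv s \<otimes> y \<in> V) \<Longrightarrow>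
    reach G N S \<F> (inv s \<otimes> x) V"
| ker: "reach G N S \<F> x U \<Longrightarrow> n \<in> N \<Longrightarrow> reach G N S \<F> (n \<otimes> x) U"

lemma reach_mono:
  assumes "reach G N S \<F> x U" "S \<subseteq> S'" "\<F> \<subseteq> \<F>'"
  shows "reach G N S' \<F>' x U"
  using assms
proof (induction)
  case (start U)
  then show ?case by (blast intro: reach.start)
next
  case (mult x U s V)
  then show ?case by (blast intro: reach.mult)
next
  case (mult_inv x U s V)
  then show ?case by (blast intro: reach.mult_inv)
next
  case (ker x U n)
  then show ?case by (blast intro: reach.ker)
qed

text \<open>All letters lie in the subgroup \<open>B\<close>, so each translation maps
  \<open>B\<close> into itself and the same witness survives the whole word.\<close>

lemma (in group) reach_generate:
  assumes "z \<in> generate G (S \<union> N)" "N \<subseteq> B" "S \<subseteq> B" "subgroup B G" "subgroup N G" "B \<in> \<F>"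
    and "reach G N S \<F> x B" "x \<in> carrier G"
  shows "reach G N S \<F> (z \<otimes> x) B"
  using assms(1,7,8)
proof (induction z arbitrary: x)
  case one
  then show ?case by simp
next
  case (incl s)
  show ?case
  proof (cases "s \<in> N")
    case False
    then show ?thesis
      using incl assms subgroup.m_closed[OF assms(4)] by (intro reach.mult[of _ _ _ _ x B]) auto
  qed (use incl in \<open>blast intro: reach.ker\<close>)
next
  case (inv s)
  show ?case
  proof (cases "s \<in> N")
    case True
    then have "inv s \<in> N" using subgroup.m_inv_closed[OF assms(5)] by blast
    then show ?thesis using inv by (blast intro: reach.ker)
  next
    case False
    then show ?thesis
      using inv assms subgroup.m_closed[OF assms(4)] subgroup.m_inv_closed[OF assms(4)]
      by (intro reach.mult_inv[of _ _ _ _ x B]) auto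
  qed
next
  case (eng a b)
  have "S \<union> N \<subseteq> carrier G" using assms subgroup.subset by blast
  then have ab: "a \<in> carrier G" "b \<in> carrier G" using eng.hyps generate_in_carrier by blast+
  have "reach G N S \<F> (a \<otimes> (b \<otimes> x)) B" using eng ab by simp
  then show ?case using ab eng.prems by (simp add: m_assoc)
qed

section \<open>Separating a cyclic extension from its lower subgroup\<close>

context cyclic_ext
begin

text \<open>The union of the left cosets \<open>q [^] i B\<close> for \<open>i\<close> in
  \<open>I\<close>.\<close>

definition layer :: "int set \<Rightarrow> 'a set" where
  "layer I = {x \<in> carrier G. \<exists>i\<in>I. q [^] (- i) \<otimes> x \<in> B}"

lemma layer_0: "layer {0} = B"
  using B_carrier by (auto simp: layer_def)

lemma layer_shift:
  assumes "x \<in> layer I"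
  shows "q \<otimes> x \<in> layer ((\<lambda>i. i + 1) ` I)" "inv q \<otimes> x \<in> layer ((\<lambda>i. i - 1) ` I)"
proof -
  obtain i where i: "i \<in> I" "q [^] (- i) \<otimes> x \<in> B" "x \<in> carrier G"
    using assms unfolding layer_def by blast
  have "q [^] (- (i + 1)) \<otimes> (q \<otimes> x) = q [^] (- i) \<otimes> x"
    using i(3) int_pow_mult[OF qG, of "- (i + 1)" 1] by (simp flip: m_assoc)
  then show "q \<otimes> x \<in> layer ((\<lambda>i. i + 1) ` I)"
    using i unfolding layer_def by (intro CollectI conjI bexI[of _ "i + 1"]) simp_all
  have "q [^] (- (i - 1)) \<otimes> (inv q \<otimes> x) = q [^] (- i) \<otimes> x"
    using i(3) int_pow_mult[OF qG, of "- (i - 1)" "- 1"] by (simp add: int_pow_neg flip: m_assoc)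
  then show "inv q \<otimes> x \<in> layer ((\<lambda>i. i - 1) ` I)"
    using i unfolding layer_def
    by (intro CollectI conjI bexI[of _ "i - 1"]) (simp_all add: int_pow_neg)
qed

lemma layer_mono: "I \<subseteq> J \<Longrightarrow> layer I \<subseteq> layer J"
  unfolding layer_def by blast

lemma layer_disjoint:
  assumes "\<And>i. i \<in> I \<Longrightarrow> q [^] i \<notin> B"
  shows "B \<inter> layer I = {}"
proof (rule ccontr)
  assume "B \<inter> layer I \<noteq> {}"
  then obtain x i where x: "x \<in> B" "i \<in> I" "q [^] (- i) \<otimes> x \<in> B" unfolding layer_def by blast
  then have "x \<otimes> inv (q [^] (- i) \<otimes> x) \<in> B" using B_mult B_inv by blast
  then have "q [^] i \<in> B"
    using B_carrier[OF x(1)] by (simp add: inv_mult_group int_pow_neg flip: m_assoc)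
  then show False using assms x by blast
qed

text \<open>An element of \<open>C - B\<close> is a power of \<open>q\<close> times an element of
  \<open>B\<close>. Read from the right, the letters for the latter keep the witness at
  \<open>B\<close>, and the letters \<open>q\<close> or \<open>inv q\<close> then push it to a layer
  that misses \<open>B\<close>.\<close>

lemma reach_step:
  assumes N: "N \<subseteq> B" "subgroup N G" and S: "S \<subseteq> B" "finite S" "generate G (S \<union> N) = B"
  obtains \<F> where "finite \<F>" "\<F> \<subseteq> Pow (carrier G)"
    "\<And>x. x \<in> C - B \<Longrightarrow> \<exists>V. reach G N (insert q S) \<F> x V \<and> B \<inter> V = {}"
proof -
  obtain r :: nat where r: "q [^] r \<in> B" "\<And>k::int. q [^] k \<in> B \<Longrightarrow> int r dvd k"
    using exponent by metis
  \<comment> \<open>If \<open>C / B\<close> is infinite (\<open>r = 0\<close>), the two half-lines separate \<open>B\<close> from the rest; otherwise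
    the single cosets do.\<close>
  define \<F> where "\<F> = {layer {0}, layer {1..}, layer {..-1}} \<union> (\<lambda>i. layer {int i}) ` {..<r}"
  have start: "reach G N (insert q S) \<F> b (layer {0})" if b: "b \<in> B" for b
  proof -
    have "reach G N S {B} \<one> B" using N(1) by (intro reach.start) auto
    then have "reach G N S {B} (b \<otimes> \<one>) B"
      using reach_generate[of b S N B "{B}" \<one>] N S subB b by simp
    then show ?thesis
      using B_carrier[OF b] reach_mono[of G N S "{B}" b B "insert q S" \<F>]
      by (auto simp: \<F>_def layer_0)
  qed
  \<comment> \<open>A half-line shifted away from 0 stays inside itself, so one fixed set witnesses
    arbitrarily many further letters. This keeps the family finite for infinite
    \<open>C / B\<close>.\<close>
  have pos: "reach G N (insert q S) \<F> (q [^] Suc n \<otimes> b) (layer {1..})"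
    "reach G N (insert q S) \<F> (q [^] (- int (Suc n)) \<otimes> b) (layer {..-1})" if b: "b \<in> B" for n b
  proof (induction n)
    case 0
    have "reach G N (insert q S) \<F> (q \<otimes> b) (layer {1..})"
      by (rule reach.mult[OF start[OF b]])
        (use layer_shift(1)[of _ "{0}"] layer_mono[of "{1}" "{1..}"] in \<open>auto simp: \<F>_def\<close>)
    then show "reach G N (insert q S) \<F> (q [^] Suc 0 \<otimes> b) (layer {1..})" by simp
    have "reach G N (insert q S) \<F> (inv q \<otimes> b) (layer {..-1})"
      by (rule reach.mult_inv[OF start[OF b]])
        (use layer_shift(2)[of _ "{0}"] layer_mono[of "{-1}" "{..-1}"] in \<open>auto simp: \<F>_def\<close>)
    then show "reach G N (insert q S) \<F> (q [^] (- int (Suc 0)) \<otimes> b) (layer {..-1})"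
      by (simp add: int_pow_neg)
  next
    case (Suc n)
    have "reach G N (insert q S) \<F> (q \<otimes> (q [^] Suc n \<otimes> b)) (layer {1..})"
    proof (rule reach.mult[OF Suc(1)])
      fix y assume "y \<in> layer {1..}"
      moreover have "layer ((\<lambda>i. i + 1) ` {1..}) \<subseteq> layer {1..}" by (rule layer_mono) auto
      ultimately show "q \<otimes> y \<in> layer {1..}" using layer_shift(1)[of y "{1..}"] by blast
    qed (auto simp: \<F>_def)
    then show "reach G N (insert q S) \<F> (q [^] Suc (Suc n) \<otimes> b) (layer {1..})"
      using B_carrier[OF b] by (simp only: nat_pow_Suc2[of q "Suc n"] m_assoc qG nat_pow_closed)
    have "reach G N (insert q S) \<F> (inv q \<otimes> (q [^] (- int (Suc n)) \<otimes> b)) (layer {..-1})"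
    proof (rule reach.mult_inv[OF Suc(2)])
      fix y assume "y \<in> layer {..-1}"
      moreover have "layer ((\<lambda>i. i - 1) ` {..-1}) \<subseteq> layer {..-1}" by (rule layer_mono) auto
      ultimately show "inv q \<otimes> y \<in> layer {..-1}" using layer_shift(2)[of y "{..-1}"] by blast
    qed (auto simp: \<F>_def)
    moreover have "inv q \<otimes> q [^] (- int (Suc n)) = q [^] (- int (Suc (Suc n)))"
      using int_pow_mult[OF qG, of "-1" "- int (Suc n)"] by (simp add: int_pow_neg)
    ultimately show "reach G N (insert q S) \<F> (q [^] (- int (Suc (Suc n))) \<otimes> b) (layer {..-1})"
      using B_carrier[OF b] by (metis inv_closed int_pow_closed m_assoc qG)
  qed
  have fin: "reach G N (insert q S) \<F> (q [^] n \<otimes> b) (layer {int n})" if b: "b \<in> B" "n < r" for n b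
    using b(2)
  proof (induction n)
    case 0
    then show ?case using start b B_carrier by simp
  next
    case (Suc n)
    have "reach G N (insert q S) \<F> (q \<otimes> (q [^] n \<otimes> b)) (layer {int (Suc n)})"
    proof (rule reach.mult)
      show "reach G N (insert q S) \<F> (q [^] n \<otimes> b) (layer {int n})" using Suc by simp
      show "layer {int (Suc n)} \<in> \<F>" using Suc.prems unfolding \<F>_def by blast
      show "q \<otimes> y \<in> layer {int (Suc n)}" if "y \<in> layer {int n}" for y
        using layer_shift(1)[OF that] by (simp add: add.commute)
    qed simp
    then show ?case
      using B_carrier[OF b(1)] by (simp only: nat_pow_Suc2[of q n] m_assoc qG nat_pow_closed)
  qed
  have "\<exists>V. reach G N (insert q S) \<F> x V \<and> B \<inter> V = {}" if x: "x \<in> C - B" for x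
  proof -
    have xG: "x \<in> carrier G" using x C_carrier by blast
    obtain k :: int where "x \<otimes> q [^] k \<in> B" using gen x by blast
    then have k: "q [^] k \<otimes> x \<in> B" using commute_mod[of x "q [^] k"] x q_pow_C by blast
    show ?thesis
    proof (cases "r = 0")
      case True
      then have no: "q [^] i \<notin> B" if "i \<noteq> 0" for i :: int using r(2)[of i] that by auto
      have xk: "x = q [^] (- k) \<otimes> (q [^] k \<otimes> x)"
        using xG by (simp add: int_pow_neg flip: m_assoc)
      have "k \<noteq> 0" using k x xG by auto
      then consider "k < 0" | "k > 0" by linarith
      then show ?thesis
      proof cases
        case 1
        then have "q [^] (- k) = q [^] Suc (nat (- k) - 1)"
          using pow_nat[of "- k" G q] by simp
        then have "reach G N (insert q S) \<F> x (layer {1..})" using pos(1)[OF k] xk by metis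
        moreover have "B \<inter> layer {1..} = {}" by (rule layer_disjoint) (use no in auto)
        ultimately show ?thesis by blast
      next
        case 2
        then have "- k = - int (Suc (nat k - 1))" by simp
        then have "reach G N (insert q S) \<F> x (layer {..-1})" using pos(2)[OF k] xk by metis
        moreover have "B \<inter> layer {..-1} = {}" by (rule layer_disjoint) (use no in auto)
        ultimately show ?thesis by blast
      qed
    next
      case False
      \<comment> \<open>The representative below \<open>r\<close> of the exponent of
        \<open>x\<close> modulo \<open>B\<close>; it names one of the finitely many single cosets in
        the family.\<close>
      define m where "m = nat ((- k) mod int r)"
      have m: "int m = (- k) mod int r" "m < r" using False unfolding m_def by (auto simp: nat_less_iff)
      have "int r dvd - int m - k" using m(1) by (metis diff_minus_eq_add minus_add_distrib
            mod_eq_dvd_iff dvd_minus_iff mod_mod_trivial add.commute uminus_add_conv_diff)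
      then obtain j where j: "- int m - k = int r * j" by blast
      have "(q [^] int r) [^] j \<in> B" using subgroup_int_pow_closed[OF subB r(1)] by (simp add: int_pow_int)
      then have "q [^] (- int m - k) \<in> B" using int_pow_pow[OF qG] j by simp
      then have "q [^] (- int m - k) \<otimes> (q [^] k \<otimes> x) \<in> B" using k B_mult by blast
      moreover have "q [^] (- int m - k) \<otimes> (q [^] k \<otimes> x) = q [^] (- int m) \<otimes> x"
        using xG by (subst m_assoc[symmetric]) (simp_all flip: int_pow_mult)
      ultimately have b: "q [^] (- int m) \<otimes> x \<in> B" by simp
      have "q [^] m \<otimes> (q [^] (- int m) \<otimes> x) = x"
        using xG by (subst m_assoc[symmetric]) (simp_all add: int_pow_neg_int)
      then have "reach G N (insert q S) \<F> x (layer {int m})" using fin[OF b m(2)] by simp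
      moreover have "B \<inter> layer {int m} = {}"
      proof (rule layer_disjoint)
        fix i assume "i \<in> {int m}"
        \<comment> \<open>For \<open>m = 0\<close> the element \<open>x\<close> would lie in
          \<open>B\<close>. Hence \<open>m\<close> is strictly between 0 and \<open>r\<close> and
          not divisible by \<open>r\<close>.\<close>
        moreover have "m \<noteq> 0" using b x xG by (intro notI) simp
        ultimately show "q [^] i \<notin> B" using m(2) r(2)[of i] zdvd_not_zless[of "int m" "int r"] by auto
      qed
      ultimately show ?thesis by blast
    qed
  qed
  moreover have "finite \<F>" "\<F> \<subseteq> Pow (carrier G)" unfolding \<F>_def layer_def by auto
  ultimately show ?thesis using that by blast
qed

end

text \<open>An element outside \<open>N\<close> leaves the series at some cyclic step. The witness
  of that step avoids the lower subgroup, hence also \<open>N\<close>, so it suffices to unite the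
  letters and the families of all steps.\<close>

lemma (in group) pc_series_reach:
  assumes "subgroup N G" "pc_series G N B"
  shows "\<exists>S \<F>. finite S \<and> S \<subseteq> B \<and> generate G (S \<union> N) = B \<and> finite \<F> \<and> \<F> \<subseteq> Pow (carrier G) \<and>
    (\<forall>x\<in>B - N. \<exists>V. reach G N S \<F> x V \<and> N \<inter> V = {})" (is "\<exists>S \<F>. ?P B S \<F>")
  using assms(2)
proof (induction)
  case base
  have "generate G N = N" using base generate_subgroup_incl[of N N] generate.incl[of _ N G] by blast
  then show ?case by (intro exI[of _ "{}"]) auto
next
  case (step B C q)
  then obtain S \<F> where P: "?P B S \<F>" by (elim exE)
  then have S: "finite S" "S \<subseteq> B" "generate G (S \<union> N) = B" "finite \<F>" "\<F> \<subseteq> Pow (carrier G)"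
    by simp_all
  have r: "\<exists>V. reach G N S \<F> x V \<and> N \<inter> V = {}" if "x \<in> B - N" for x
    using P that by (elim conjE bspec)
  interpret E: cyclic_ext G B C q by (rule step)
  have N: "N \<subseteq> B" by (rule pc_series_subgroup(3)[OF step(1)])
  obtain \<F>' where F': "finite \<F>'" "\<F>' \<subseteq> Pow (carrier G)"
    "\<And>x. x \<in> C - B \<Longrightarrow> \<exists>V. reach G N (insert q S) \<F>' x V \<and> B \<inter> V = {}"
    using E.reach_step[OF N assms(1) S(2,1,3)] by blast
  have "\<exists>V. reach G N (insert q S) (\<F> \<union> \<F>') x V \<and> N \<inter> V = {}" if x: "x \<in> C - N" for x
  proof (cases "x \<in> B")
    case True
    then obtain V where "reach G N S \<F> x V" "N \<inter> V = {}" using r x by blast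
    then show ?thesis using reach_mono[of G N S \<F> x V "insert q S" "\<F> \<union> \<F>'"] by blast
  next
    case False
    then obtain V where "reach G N (insert q S) \<F>' x V" "B \<inter> V = {}" using F'(3) x by blast
    then show ?thesis
      using reach_mono[of G N "insert q S" \<F>' x V "insert q S" "\<F> \<union> \<F>'"] N by blast
  qed
  moreover have "generate G (insert q S \<union> N) = C"
    by (rule E.generate_ext[OF S(3)]) (use E.qC E.BC S N in auto)
  moreover have "insert q S \<subseteq> C" "finite (insert q S)" "finite (\<F> \<union> \<F>')" "\<F> \<union> \<F>' \<subseteq> Pow (carrier G)"
    using S F' E.qC E.BC by auto
  ultimately have "?P C (insert q S) (\<F> \<union> \<F>')" by simp
  then show ?case by (intro exI)
qed

subsection \<open>Transfer of finite families of sets along two-sided configurations\<close>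

lemma config_pair_block:
  assumes "config_pair G gs Es" "z \<in> carrier G"
  obtains j where "j \<in> {1..length Es}" "z \<in> Es ! (j - 1)"
proof -
  have "z \<in> \<Union> (set Es)" using assms unfolding config_pair_def partition_on_def by blast
  then obtain i where "i < length Es" "z \<in> Es ! i" by (auto simp: in_set_conv_nth)
  then show ?thesis using that[of "Suc i"] by auto
qed

lemma config_pair_block_unique:
  assumes "config_pair G gs Es" "z \<in> Es ! i" "z \<in> Es ! j" "i < length Es" "j < length Es"
  shows "i = j"
proof (rule ccontr)
  assume "i \<noteq> j"
  then have "Es ! i \<noteq> Es ! j" using assms unfolding config_pair_def by (simp add: nth_eq_iff_index_eq)
  then have "disjnt (Es ! i) (Es ! j)"
    using assms unfolding config_pair_def partition_on_def disjoint_def disjnt_def by simp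
  then show False using assms unfolding disjnt_def by blast
qed

text \<open>The configuration lists the block indices of \<open>x\<close>, then those of its left
  translates, then those of its right translates. Thus no element escapes comparison through
  configurations.\<close>

lemma Con_t_pair_realize:
  assumes "group G" "config_pair G gs Es" "x \<in> carrier G"
  obtains C where "C \<in> Con_t_pair G gs Es" "x \<in> Es ! (C ! 0 - 1)"
    "\<And>i. i \<in> {1..length gs} \<Longrightarrow> gs ! (i - 1) \<otimes>\<^bsub>G\<^esub> x \<in> Es ! (C ! i - 1) \<and>
        x \<otimes>\<^bsub>G\<^esub> gs ! (i - 1) \<in> Es ! (C ! (i + length gs) - 1)"
proof -
  interpret group G by fact
  have "\<forall>z\<in>carrier G. \<exists>j. j \<in> {1..length Es} \<and> z \<in> Es ! (j - 1)"
    using config_pair_block[OF assms(2)] by blast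
  then obtain ix where ix: "\<And>z. z \<in> carrier G \<Longrightarrow> ix z \<in> {1..length Es} \<and> z \<in> Es ! (ix z - 1)"
    by metis
  define zs where "zs = x # map (\<lambda>g. g \<otimes>\<^bsub>G\<^esub> x) gs @ map (\<lambda>g. x \<otimes>\<^bsub>G\<^esub> g) gs"
  define C where "C = map ix zs"
  have gs: "set gs \<subseteq> carrier G" using assms(2) unfolding config_pair_def by blast
  have zs: "set zs \<subseteq> carrier G" using gs assms(3) unfolding zs_def by auto
  have len: "length zs = 2 * length gs + 1" unfolding zs_def by simp
  have block: "zs ! i \<in> Es ! (C ! i - 1)" if "i < length zs" for i
    using ix[of "zs ! i"] zs that unfolding C_def by (simp add: subset_iff)
  have 0: "x \<in> Es ! (C ! 0 - 1)" using block[of 0] unfolding zs_def by simp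
  have i: "gs ! (i - 1) \<otimes>\<^bsub>G\<^esub> x \<in> Es ! (C ! i - 1) \<and>
        x \<otimes>\<^bsub>G\<^esub> gs ! (i - 1) \<in> Es ! (C ! (i + length gs) - 1)" if i: "i \<in> {1..length gs}" for i
  proof -
    have "zs ! i = gs ! (i - 1) \<otimes>\<^bsub>G\<^esub> x" "zs ! (i + length gs) = x \<otimes>\<^bsub>G\<^esub> gs ! (i - 1)"
      using i unfolding zs_def by (auto simp: nth_Cons' nth_append)
    then show ?thesis using block[of i] block[of "i + length gs"] i len by auto
  qed
  have "set C \<subseteq> {1..length Es}" using ix zs unfolding C_def by auto
  moreover have "length C = 2 * length gs + 1" using len unfolding C_def by simp
  ultimately have "C \<in> Con_t_pair G gs Es"
    using 0 i unfolding Con_t_pair_def two_sided_config_def by blast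
  then show ?thesis using that 0 i by blast
qed

text \<open>\<open>G\<close> is partitioned into the atoms of the finite family, and
  \<open>A V\<close> unites the blocks of \<open>H\<close> whose indices belong to atoms inside
  \<open>V\<close>. Elements with the same configuration then have the same membership pattern, also
  after translation by one generator on either side.\<close>

lemma Con_t_transfer:
  fixes G :: "('a, 'b) monoid_scheme" and H :: "('c, 'd) monoid_scheme"
  assumes G: "group G" and H: "group H" and Con: "Con_t G \<subseteq> Con_t H"
    and T: "finite T" "T \<subseteq> carrier G" "generate G T = carrier G"
    and F: "finite \<V>"
  obtains h A where "h ` T \<subseteq> carrier H" "generate H (h ` T) = carrier H"
    "\<forall>V. A V \<subseteq> carrier H"
    "\<forall>y\<in>carrier H. \<exists>x\<in>carrier G. \<forall>V\<in>\<V>. (y \<in> A V \<longleftrightarrow> x \<in> V) \<and>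
        (\<forall>t\<in>T. (h t \<otimes>\<^bsub>H\<^esub> y \<in> A V \<longleftrightarrow> t \<otimes>\<^bsub>G\<^esub> x \<in> V) \<and> (y \<otimes>\<^bsub>H\<^esub> h t \<in> A V \<longleftrightarrow> x \<otimes>\<^bsub>G\<^esub> t \<in> V))"
    "\<forall>x\<in>carrier G. \<exists>y\<in>carrier H. \<forall>V\<in>\<V>. y \<in> A V \<longleftrightarrow> x \<in> V"
proof -
  \<comment> \<open>\<open>tr x\<close> is the membership pattern of \<open>x\<close>, and
    \<open>cl x\<close> is the atom of the family that contains \<open>x\<close>.\<close>
  define tr where "tr x = {V \<in> \<V>. x \<in> V}" for x
  define cl where "cl x = {z \<in> carrier G. tr z = tr x}" for x
  have "cl ` carrier G \<subseteq> (\<lambda>K. {z \<in> carrier G. tr z = K}) ` Pow \<V>"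
    unfolding cl_def tr_def by auto
  then have "finite (cl ` carrier G)" by (rule finite_subset) (use F in simp)
  then obtain Es where Es: "set Es = cl ` carrier G" "distinct Es"
    using finite_distinct_list[of "cl ` carrier G"] by auto
  obtain gs where gs: "set gs = T" "distinct gs" using finite_distinct_list[OF T(1)] by auto
  have "partition_on (carrier G) (cl ` carrier G)"
    unfolding partition_on_def disjoint_def cl_def by auto
  then have cG: "config_pair G gs Es" using Es gs T unfolding config_pair_def by simp
  then have "Con_t_pair G gs Es \<in> Con_t G" unfolding Con_t_def by blast
  then have "Con_t_pair G gs Es \<in> Con_t H" using Con by blast
  then obtain hs Fs where cH: "config_pair H hs Fs" and eq: "Con_t_pair G gs Es = Con_t_pair H hs Fs"
    unfolding Con_t_def by blast
  \<comment> \<open>One common configuration is enough to see from its length that the two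
    generating tuples have equally many entries.\<close>
  have "\<one>\<^bsub>G\<^esub> \<in> carrier G" using G by (simp add: group.is_monoid)
  then obtain C where C: "C \<in> Con_t_pair G gs Es" using Con_t_pair_realize[OF G cG] by blast
  then have "C \<in> Con_t_pair H hs Fs" using eq by simp
  then have len: "length hs = length gs"
    using C unfolding Con_t_pair_def two_sided_config_def by simp
  \<comment> \<open>Generators correspond by position. This is well defined since \<open>gs\<close>
    has no repetitions, while \<open>hs\<close> may have some.\<close>
  define h where "h t = hs ! inv_into {..<length gs} ((!) gs) t" for t
  have h: "h (gs ! i) = hs ! i" if "i < length gs" for i
    using that gs(2) unfolding h_def by (simp add: inv_into_f_f inj_on_nth)
  have hT: "h ` T = set hs"
  proof -
    have "map h gs = hs" using h len by (intro nth_equalityI) auto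
    then show ?thesis using gs(1) by (metis set_map)
  qed
  \<comment> \<open>The two partitions have not been shown to have equally many blocks, so the index
    is required to be valid in both. Every index occurring in a configuration is.\<close>
  define A where "A V = {y. \<exists>j<length Fs. y \<in> Fs ! j \<and> j < length Es \<and> Es ! j \<subseteq> V}" for V
  have Fs: "\<Union> (set Fs) = carrier H" using cH unfolding config_pair_def partition_on_def by blast
  have A_iff: "y \<in> A V \<longleftrightarrow> x \<in> V"
    if x: "x \<in> Es ! (c - 1)" and y: "y \<in> Fs ! (c - 1)" and c: "c \<in> {1..length Es}" "c \<in> {1..length Fs}"
      and V: "V \<in> \<V>" for x y c V
  proof
    assume "y \<in> A V"
    then obtain j where j: "j < length Fs" "y \<in> Fs ! j" "Es ! j \<subseteq> V" unfolding A_def by blast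
    have "c - 1 < length Fs" using c by auto
    then have "j = c - 1" using config_pair_block_unique[OF cH j(2) y j(1)] by blast
    then show "x \<in> V" using x j by blast
  next
    assume xV: "x \<in> V"
    have "c - 1 < length Es" "c - 1 < length Fs" using c by auto
    then have "Es ! (c - 1) \<in> cl ` carrier G" using Es nth_mem by blast
    then have "Es ! (c - 1) \<subseteq> V" using x xV V unfolding cl_def tr_def by auto
    then show "y \<in> A V" using \<open>c - 1 < length Es\<close> \<open>c - 1 < length Fs\<close> y unfolding A_def by blast
  qed
  have sets: "set C \<subseteq> {1..length Es}" "set C \<subseteq> {1..length Fs}" "length C = 2 * length gs + 1"
    if "C \<in> Con_t_pair G gs Es" for C
  proof -
    have "C \<in> Con_t_pair H hs Fs" using that eq by simp
    then show "set C \<subseteq> {1..length Es}" "set C \<subseteq> {1..length Fs}" "length C = 2 * length gs + 1"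
      using that unfolding Con_t_pair_def two_sided_config_def by auto
  qed
  have nth: "C ! i \<in> {1..length Es}" "C ! i \<in> {1..length Fs}"
    if "C \<in> Con_t_pair G gs Es" "i < 2 * length gs + 1" for C i
    using sets[OF that(1)] that(2) nth_mem[of i C] by (auto simp del: atLeastAtMost_iff)
  show ?thesis
  proof (rule that[of h A])
    show "h ` T \<subseteq> carrier H" "generate H (h ` T) = carrier H"
      using cH hT unfolding config_pair_def by auto
    show "\<forall>V. A V \<subseteq> carrier H" using Fs unfolding A_def by force
  next
    show "\<forall>y\<in>carrier H. \<exists>x\<in>carrier G. \<forall>V\<in>\<V>. (y \<in> A V \<longleftrightarrow> x \<in> V) \<and>
        (\<forall>t\<in>T. (h t \<otimes>\<^bsub>H\<^esub> y \<in> A V \<longleftrightarrow> t \<otimes>\<^bsub>G\<^esub> x \<in> V) \<and> (y \<otimes>\<^bsub>H\<^esub> h t \<in> A V \<longleftrightarrow> x \<otimes>\<^bsub>G\<^esub> t \<in> V))"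
    proof
      fix y assume "y \<in> carrier H"
      \<comment> \<open>A configuration of \<open>y\<close> is also one of the pair in
        \<open>G\<close>; any \<open>x\<close> realizing it there is the required partner.\<close>
      then obtain C where C: "C \<in> Con_t_pair H hs Fs" "y \<in> Fs ! (C ! 0 - 1)"
        and Ci: "\<And>i. i \<in> {1..length hs} \<Longrightarrow> hs ! (i - 1) \<otimes>\<^bsub>H\<^esub> y \<in> Fs ! (C ! i - 1) \<and>
          y \<otimes>\<^bsub>H\<^esub> hs ! (i - 1) \<in> Fs ! (C ! (i + length hs) - 1)"
        using Con_t_pair_realize[OF H cH] by blast
      then have CG: "C \<in> Con_t_pair G gs Es" using eq by simp
      then obtain x where x: "x \<in> Es ! (C ! 0 - 1)"
        and xi: "\<And>i. i \<in> {1..length gs} \<Longrightarrow> gs ! (i - 1) \<otimes>\<^bsub>G\<^esub> x \<in> Es ! (C ! i - 1) \<and>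
          x \<otimes>\<^bsub>G\<^esub> gs ! (i - 1) \<in> Es ! (C ! (i + length gs) - 1)"
        unfolding Con_t_pair_def two_sided_config_def by blast
      have "C ! 0 - 1 < length Es" using nth(1)[OF CG, of 0] by auto
      then have "Es ! (C ! 0 - 1) \<in> cl ` carrier G" using Es nth_mem by blast
      then have xG: "x \<in> carrier G" using x unfolding cl_def by auto
      have 0: "y \<in> A V \<longleftrightarrow> x \<in> V" if "V \<in> \<V>" for V
        using A_iff[OF x C(2)] nth[OF CG, of 0] that by simp
      have t: "(h t \<otimes>\<^bsub>H\<^esub> y \<in> A V \<longleftrightarrow> t \<otimes>\<^bsub>G\<^esub> x \<in> V) \<and> (y \<otimes>\<^bsub>H\<^esub> h t \<in> A V \<longleftrightarrow> x \<otimes>\<^bsub>G\<^esub> t \<in> V)"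
        if V: "V \<in> \<V>" and tT: "t \<in> T" for V t
      proof -
        obtain i where i: "i < length gs" "t = gs ! i" using gs(1) tT by (auto simp: in_set_conv_nth)
        have i': "Suc i \<in> {1..length gs}" using i by simp
        have hi: "h t = hs ! i" using h i by simp
        have lt: "Suc i < 2 * length gs + 1" "Suc i + length gs < 2 * length gs + 1" using i by auto
        show ?thesis
          using A_iff[OF _ _ nth[OF CG lt(1)] V, of "t \<otimes>\<^bsub>G\<^esub> x" "h t \<otimes>\<^bsub>H\<^esub> y"]
            A_iff[OF _ _ nth[OF CG lt(2)] V, of "x \<otimes>\<^bsub>G\<^esub> t" "y \<otimes>\<^bsub>H\<^esub> h t"]
            Ci[of "Suc i"] xi[of "Suc i"] i' len hi i(2)
          by simp
    qed
    show "\<exists>x\<in>carrier G. \<forall>V\<in>\<V>. (y \<in> A V \<longleftrightarrow> x \<in> V) \<and>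
        (\<forall>t\<in>T. (h t \<otimes>\<^bsub>H\<^esub> y \<in> A V \<longleftrightarrow> t \<otimes>\<^bsub>G\<^esub> x \<in> V) \<and> (y \<otimes>\<^bsub>H\<^esub> h t \<in> A V \<longleftrightarrow> x \<otimes>\<^bsub>G\<^esub> t \<in> V))"
      using xG 0 t by blast
    qed
  next
    show "\<forall>x\<in>carrier G. \<exists>y\<in>carrier H. \<forall>V\<in>\<V>. y \<in> A V \<longleftrightarrow> x \<in> V"
    proof
      fix x assume "x \<in> carrier G"
      then obtain C where C: "C \<in> Con_t_pair G gs Es" "x \<in> Es ! (C ! 0 - 1)"
        using Con_t_pair_realize[OF G cG] by blast
      then have "C \<in> Con_t_pair H hs Fs" using eq by simp
      then obtain y where y: "y \<in> Fs ! (C ! 0 - 1)"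
        unfolding Con_t_pair_def two_sided_config_def by blast
      have "C ! 0 - 1 < length Fs" using nth(2)[OF C(1), of 0] by auto
      then have "y \<in> carrier H" using Fs y nth_mem by blast
      moreover have "y \<in> A V \<longleftrightarrow> x \<in> V" if "V \<in> \<V>" for V
        using A_iff[OF C(2) y] nth[OF C(1), of 0] that by simp
      ultimately show "\<exists>y\<in>carrier H. \<forall>V\<in>\<V>. y \<in> A V \<longleftrightarrow> x \<in> V" by blast
    qed
  qed
qed

subsection \<open>Polycyclic quotients are shared\<close>

text \<open>The presentation makes \<open>\<psi>\<close> exist, the fact that the elements
  \<open>h t\<close> generate \<open>H\<close> makes it onto, and the separating family keeps its
  kernel inside \<open>N\<close>.\<close>

lemma pc_quotient_transfer:
  fixes G :: "('a, 'b) monoid_scheme" and H :: "('c, 'd) monoid_scheme"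
  assumes fgG: "fin_gen_group G" and H: "group H" and Con: "Con_t G \<subseteq> Con_t H"
    and N: "N \<lhd> G" and pc: "pc_series G N (carrier G)"
  obtains L \<psi> where "L \<lhd> H" "\<psi> \<in> hom G (H Mod L)" "\<psi> ` carrier G = carrier (H Mod L)"
    "kernel G (H Mod L) \<psi> = N"
proof -
  interpret G: group G using fgG unfolding fin_gen_group_def by blast
  interpret H: group H by fact
  interpret N: normal N G by fact
  obtain X where X: "finite X" "X \<subseteq> carrier G" "generate G X = carrier G"
    using fgG unfolding fin_gen_group_def by blast
  \<comment> \<open>The type argument is that of cosets in \<open>H\<close>, because the
    presentation will be mapped to \<open>H Mod L\<close>.\<close>
  obtain S0 where S0: "presents TYPE('c set) G N (carrier G) S0"
    using G.pc_series_presents[OF N pc] by blast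
  obtain S1 \<F> where S1: "finite S1" "S1 \<subseteq> carrier G" "finite \<F>"
    and r1: "\<forall>x\<in>carrier G - N. \<exists>V. reach G N S1 \<F> x V \<and> N \<inter> V = {}"
    using G.pc_series_reach[OF N.is_subgroup pc] by (elim exE conjE)
  \<comment> \<open>A single set serves as presenting table, as alphabet of the separating words and
    as generating tuple of the configuration pair.\<close>
  obtain T where T: "S1 \<union> X \<subseteq> T" and pT: "presents TYPE('c set) G N (carrier G) T"
    using G.presents_extend[OF _ _ S0, of "S1 \<union> X"] S1 X by auto
  have Tc: "finite T" "T \<subseteq> carrier G" "\<one>\<^bsub>G\<^esub> \<in> T" using pT unfolding presents_def by blast+
  have Tg: "generate G T = carrier G"
    using G.mono_generate[of X T] T X(3) G.generate_incl[OF Tc(2)] by blast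
  have r: "\<exists>V. reach G N T \<F> x V \<and> N \<inter> V = {}" if x: "x \<in> carrier G - N" for x
  proof -
    obtain V where "reach G N S1 \<F> x V" "N \<inter> V = {}" using r1 x by blast
    then show ?thesis using reach_mono[of G N S1 \<F> x V T \<F>] T by blast
  qed
  \<comment> \<open>The coset \<open>t N\<close>. With these cosets in the family, configurations
    record how the table of \<open>T\<close> acts on them.\<close>
  define cs where "cs t = {x \<in> carrier G. inv\<^bsub>G\<^esub> t \<otimes>\<^bsub>G\<^esub> x \<in> N}" for t
  define \<V> where "\<V> = insert N (\<F> \<union> cs ` T)"
  have "finite \<V>" using S1 Tc unfolding \<V>_def by simp
  then obtain h A where h: "h ` T \<subseteq> carrier H" "generate H (h ` T) = carrier H"
    and A0: "\<forall>V. A V \<subseteq> carrier H"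
    and tr0: "\<forall>y\<in>carrier H. \<exists>x\<in>carrier G. \<forall>V\<in>\<V>. (y \<in> A V \<longleftrightarrow> x \<in> V) \<and>
        (\<forall>t\<in>T. (h t \<otimes>\<^bsub>H\<^esub> y \<in> A V \<longleftrightarrow> t \<otimes>\<^bsub>G\<^esub> x \<in> V) \<and> (y \<otimes>\<^bsub>H\<^esub> h t \<in> A V \<longleftrightarrow> x \<otimes>\<^bsub>G\<^esub> t \<in> V))"
    and tr0': "\<forall>x\<in>carrier G. \<exists>y\<in>carrier H. \<forall>V\<in>\<V>. y \<in> A V \<longleftrightarrow> x \<in> V"
    by (rule Con_t_transfer[OF G.is_group H Con Tc(1,2) Tg]) (rule that)
  note A = A0[rule_format] and tr = bspec[OF tr0] and tr' = bspec[OF tr0']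
  have hT: "h t \<in> carrier H" if "t \<in> T" for t using h that by blast
  have V: "N \<in> \<V>" "\<And>U. U \<in> \<F> \<Longrightarrow> U \<in> \<V>" "\<And>t. t \<in> T \<Longrightarrow> cs t \<in> \<V>" unfolding \<V>_def by auto

  have tr1: "\<exists>x\<in>carrier G. \<forall>V\<in>\<V>. y \<in> A V \<longleftrightarrow> x \<in> V" if "y \<in> carrier H" for y
    using tr[OF that] by (elim bexE, intro bexI) auto
  \<comment> \<open>A relation \<open>a b = c\<close> modulo \<open>N\<close> says that translation
    by \<open>a\<close> carries exactly the coset \<open>b N\<close> to \<open>c N\<close>; the
    partner in \<open>G\<close> transports this to \<open>H\<close>.\<close>
  have rel: "y \<in> A (cs b) \<longleftrightarrow> h a \<otimes>\<^bsub>H\<^esub> y \<in> A (cs c)"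
    if abc: "a \<in> T" "b \<in> T" "c \<in> T" "a \<otimes>\<^bsub>G\<^esub> b \<otimes>\<^bsub>G\<^esub> inv\<^bsub>G\<^esub> c \<in> N" and y: "y \<in> carrier H" for a b c y
  proof -
    obtain x where x: "x \<in> carrier G"
      "\<forall>V\<in>\<V>. (y \<in> A V \<longleftrightarrow> x \<in> V) \<and>
        (\<forall>t\<in>T. (h t \<otimes>\<^bsub>H\<^esub> y \<in> A V \<longleftrightarrow> t \<otimes>\<^bsub>G\<^esub> x \<in> V) \<and> (y \<otimes>\<^bsub>H\<^esub> h t \<in> A V \<longleftrightarrow> x \<otimes>\<^bsub>G\<^esub> t \<in> V))"
      using tr[OF y] by blast
    have G: "a \<in> carrier G" "b \<in> carrier G" "c \<in> carrier G" using abc Tc by auto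
    let ?n = "inv\<^bsub>G\<^esub> c \<otimes>\<^bsub>G\<^esub> (a \<otimes>\<^bsub>G\<^esub> b \<otimes>\<^bsub>G\<^esub> inv\<^bsub>G\<^esub> c) \<otimes>\<^bsub>G\<^esub> c"
    have n: "?n \<in> N" using N.inv_op_closed1[OF G(3) abc(4)] .
    have e: "inv\<^bsub>G\<^esub> c \<otimes>\<^bsub>G\<^esub> (a \<otimes>\<^bsub>G\<^esub> x) = ?n \<otimes>\<^bsub>G\<^esub> (inv\<^bsub>G\<^esub> b \<otimes>\<^bsub>G\<^esub> x)"
      using G x(1) by (simp add: G.m_assoc flip: G.m_assoc[of "inv\<^bsub>G\<^esub> c" c "inv\<^bsub>G\<^esub> b \<otimes>\<^bsub>G\<^esub> x"] G.m_assoc[of b "inv\<^bsub>G\<^esub> b" x])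
    have "inv\<^bsub>G\<^esub> c \<otimes>\<^bsub>G\<^esub> (a \<otimes>\<^bsub>G\<^esub> x) \<in> N \<longleftrightarrow> inv\<^bsub>G\<^esub> b \<otimes>\<^bsub>G\<^esub> x \<in> N"
    proof
      assume "inv\<^bsub>G\<^esub> c \<otimes>\<^bsub>G\<^esub> (a \<otimes>\<^bsub>G\<^esub> x) \<in> N"
      then have "inv\<^bsub>G\<^esub> ?n \<otimes>\<^bsub>G\<^esub> (?n \<otimes>\<^bsub>G\<^esub> (inv\<^bsub>G\<^esub> b \<otimes>\<^bsub>G\<^esub> x)) \<in> N"
        unfolding e using n N.m_inv_closed N.m_closed by blast
      moreover have "inv\<^bsub>G\<^esub> ?n \<otimes>\<^bsub>G\<^esub> (?n \<otimes>\<^bsub>G\<^esub> (inv\<^bsub>G\<^esub> b \<otimes>\<^bsub>G\<^esub> x)) = inv\<^bsub>G\<^esub> b \<otimes>\<^bsub>G\<^esub> x"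
        using N.mem_carrier[OF n] G x(1) by (subst G.m_assoc[symmetric]) auto
      ultimately show "inv\<^bsub>G\<^esub> b \<otimes>\<^bsub>G\<^esub> x \<in> N" by simp
    next
      assume "inv\<^bsub>G\<^esub> b \<otimes>\<^bsub>G\<^esub> x \<in> N"
      then show "inv\<^bsub>G\<^esub> c \<otimes>\<^bsub>G\<^esub> (a \<otimes>\<^bsub>G\<^esub> x) \<in> N" unfolding e using n N.m_closed by blast
    qed
    then have "x \<in> cs b \<longleftrightarrow> a \<otimes>\<^bsub>G\<^esub> x \<in> cs c" using G x(1) unfolding cs_def by simp
    then show ?thesis using x(2) V(3)[OF abc(2)] V(3)[OF abc(3)] abc(1) by blast
  qed
  have cs1: "cs \<one>\<^bsub>G\<^esub> = N" using N.subset unfolding cs_def by auto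
  have rel1: "y \<in> A N \<longleftrightarrow> h a \<otimes>\<^bsub>H\<^esub> y \<in> A (cs a)" if "a \<in> T" "y \<in> carrier H" for a y
    using rel[of a "\<one>\<^bsub>G\<^esub>" a y] that Tc cs1 by (simp add: subset_iff)
  \<comment> \<open>This is where right translates enter: \<open>t x\<close> and \<open>x t\<close>
    are conjugate, so normality puts both or neither into \<open>N\<close>.\<close>
  have comm1: "h t \<otimes>\<^bsub>H\<^esub> y \<in> A N \<longleftrightarrow> y \<otimes>\<^bsub>H\<^esub> h t \<in> A N" if t: "t \<in> T" and y: "y \<in> carrier H" for t y
  proof -
    obtain x where x: "x \<in> carrier G" "h t \<otimes>\<^bsub>H\<^esub> y \<in> A N \<longleftrightarrow> t \<otimes>\<^bsub>G\<^esub> x \<in> N"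
      "y \<otimes>\<^bsub>H\<^esub> h t \<in> A N \<longleftrightarrow> x \<otimes>\<^bsub>G\<^esub> t \<in> N"
      using tr[OF y] V(1) t by blast
    have tG: "t \<in> carrier G" using t Tc by blast
    have "t \<otimes>\<^bsub>G\<^esub> x \<in> N \<longleftrightarrow> x \<otimes>\<^bsub>G\<^esub> t \<in> N"
      using N.inv_op_closed1[OF tG, of "t \<otimes>\<^bsub>G\<^esub> x"] N.inv_op_closed2[OF tG, of "x \<otimes>\<^bsub>G\<^esub> t"] tG x(1)
      by (auto simp: G.m_assoc simp flip: G.m_assoc[of "inv\<^bsub>G\<^esub> t" t])
    then show ?thesis using x by simp
  qed
  have comm: "u \<otimes>\<^bsub>H\<^esub> y \<in> A N \<longleftrightarrow> y \<otimes>\<^bsub>H\<^esub> u \<in> A N" if u: "u \<in> carrier H" and y: "y \<in> carrier H" for u y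
  proof -
    have "u \<in> generate H (h ` T)" using u h by simp
    then show ?thesis using y
    proof (induction u arbitrary: y)
      case one
      then show ?case by simp
    next
      case (incl u)
      then show ?case using comm1 by auto
    next
      case (inv u)
      then obtain t where t: "t \<in> T" "u = h t" by blast
      then have uH: "u \<in> carrier H" using hT by blast
      \<comment> \<open>Chosen so that multiplying it by \<open>u\<close> on the left and on the
        right gives the two products with \<open>inv u\<close> to be compared.\<close>
      let ?y = "inv\<^bsub>H\<^esub> u \<otimes>\<^bsub>H\<^esub> y \<otimes>\<^bsub>H\<^esub> inv\<^bsub>H\<^esub> u"
      have "h t \<otimes>\<^bsub>H\<^esub> ?y = y \<otimes>\<^bsub>H\<^esub> inv\<^bsub>H\<^esub> u" "?y \<otimes>\<^bsub>H\<^esub> h t = inv\<^bsub>H\<^esub> u \<otimes>\<^bsub>H\<^esub> y"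
        using uH inv(2) unfolding t(2)[symmetric]
        by (simp_all add: H.m_assoc flip: H.m_assoc[of u "inv\<^bsub>H\<^esub> u"])
      then show ?case using comm1[OF t(1), of ?y] uH inv(2) by simp
    next
      case (eng u v)
      have uv: "u \<in> carrier H" "v \<in> carrier H" using eng.hyps h by auto
      have "u \<otimes>\<^bsub>H\<^esub> v \<otimes>\<^bsub>H\<^esub> y \<in> A N \<longleftrightarrow> v \<otimes>\<^bsub>H\<^esub> y \<otimes>\<^bsub>H\<^esub> u \<in> A N"
        using eng.IH(1)[of "v \<otimes>\<^bsub>H\<^esub> y"] uv eng.prems by (simp add: H.m_assoc)
      also have "\<dots> \<longleftrightarrow> y \<otimes>\<^bsub>H\<^esub> (u \<otimes>\<^bsub>H\<^esub> v) \<in> A N"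
        using eng.IH(2)[of "y \<otimes>\<^bsub>H\<^esub> u"] uv eng.prems by (simp add: H.m_assoc)
      finally show ?case .
    qed
  qed

  \<comment> \<open>The stabilizer of the block corresponding to \<open>N\<close>; it is normal because that block is closed
    under conjugation.\<close>
  define L where "L = {u \<in> carrier H. \<forall>y\<in>carrier H. u \<otimes>\<^bsub>H\<^esub> y \<in> A N \<longleftrightarrow> y \<in> A N}"
  have Lsub: "subgroup L H"
  proof
    show "inv\<^bsub>H\<^esub> u \<in> L" if u: "u \<in> L" for u
    proof -
      have uH: "u \<in> carrier H" using u unfolding L_def by blast
      have "inv\<^bsub>H\<^esub> u \<otimes>\<^bsub>H\<^esub> y \<in> A N \<longleftrightarrow> y \<in> A N" if y: "y \<in> carrier H" for y
      proof -
        have "u \<otimes>\<^bsub>H\<^esub> (inv\<^bsub>H\<^esub> u \<otimes>\<^bsub>H\<^esub> y) \<in> A N \<longleftrightarrow> inv\<^bsub>H\<^esub> u \<otimes>\<^bsub>H\<^esub> y \<in> A N"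
          using u uH y unfolding L_def by blast
        then show ?thesis using uH y by (simp flip: H.m_assoc)
      qed
      then show ?thesis using uH unfolding L_def by blast
    qed
    show "u \<otimes>\<^bsub>H\<^esub> v \<in> L" if "u \<in> L" "v \<in> L" for u v
      using that unfolding L_def by (simp add: H.m_assoc)
  qed (auto simp: L_def)
  have LH: "L \<subseteq> carrier H" unfolding L_def by blast
  have "L \<lhd> H"
  proof (rule H.normal_invI[OF Lsub])
    fix v u assume v: "v \<in> carrier H" and u: "u \<in> L"
    have uH: "u \<in> carrier H" using u LH by blast
    have "v \<otimes>\<^bsub>H\<^esub> u \<otimes>\<^bsub>H\<^esub> inv\<^bsub>H\<^esub> v \<otimes>\<^bsub>H\<^esub> y \<in> A N \<longleftrightarrow> y \<in> A N" if y: "y \<in> carrier H" for y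
    proof -
      have "v \<otimes>\<^bsub>H\<^esub> u \<otimes>\<^bsub>H\<^esub> inv\<^bsub>H\<^esub> v \<otimes>\<^bsub>H\<^esub> y \<in> A N \<longleftrightarrow> u \<otimes>\<^bsub>H\<^esub> (inv\<^bsub>H\<^esub> v \<otimes>\<^bsub>H\<^esub> y \<otimes>\<^bsub>H\<^esub> v) \<in> A N"
        using comm[of v "u \<otimes>\<^bsub>H\<^esub> inv\<^bsub>H\<^esub> v \<otimes>\<^bsub>H\<^esub> y"] v uH y by (simp add: H.m_assoc)
      also have "\<dots> \<longleftrightarrow> inv\<^bsub>H\<^esub> v \<otimes>\<^bsub>H\<^esub> y \<otimes>\<^bsub>H\<^esub> v \<in> A N"
        using u v y unfolding L_def by simp
      also have "\<dots> \<longleftrightarrow> y \<in> A N"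
        using comm[of v "inv\<^bsub>H\<^esub> v \<otimes>\<^bsub>H\<^esub> y"] v y by (simp flip: H.m_assoc)
      finally show ?thesis .
    qed
    then show "v \<otimes>\<^bsub>H\<^esub> u \<otimes>\<^bsub>H\<^esub> inv\<^bsub>H\<^esub> v \<in> L" using v uH unfolding L_def by simp
  qed
  then interpret L: normal L H .
  interpret Q: group "H Mod L" by (rule L.factorgroup_is_group)
  interpret p: group_hom H "H Mod L" "\<lambda>u. L #>\<^bsub>H\<^esub> u" by (rule L.FactGroup_group_hom)

  have "partial_hom G N T (H Mod L) (\<lambda>t. L #>\<^bsub>H\<^esub> h t)"
    unfolding partial_hom_def
  proof (intro conjI ballI impI)
    show "(\<lambda>t. L #>\<^bsub>H\<^esub> h t) \<in> T \<rightarrow> carrier (H Mod L)" using hT p.hom_closed by blast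
    fix a b c assume abc: "a \<in> T" "b \<in> T" "c \<in> T" "a \<otimes>\<^bsub>G\<^esub> b \<otimes>\<^bsub>G\<^esub> inv\<^bsub>G\<^esub> c \<in> N"
    \<comment> \<open>Translation by \<open>h a\<close> after \<open>h b\<close>, and translation by
      \<open>h c\<close>, both match \<open>A N\<close> exactly with \<open>A (cs c)\<close>. Their
      discrepancy \<open>?u\<close> therefore stabilizes \<open>A N\<close>.\<close>
    let ?u = "inv\<^bsub>H\<^esub> (h c) \<otimes>\<^bsub>H\<^esub> (h a \<otimes>\<^bsub>H\<^esub> h b)"
    have cl: "h a \<in> carrier H" "h b \<in> carrier H" "h c \<in> carrier H" using hT abc by auto
    have "?u \<otimes>\<^bsub>H\<^esub> y \<in> A N \<longleftrightarrow> y \<in> A N" if y: "y \<in> carrier H" for y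
    proof -
      have "y \<in> A N \<longleftrightarrow> h a \<otimes>\<^bsub>H\<^esub> (h b \<otimes>\<^bsub>H\<^esub> y) \<in> A (cs c)"
        using rel1[OF abc(2) y] rel[OF abc, of "h b \<otimes>\<^bsub>H\<^esub> y"] cl y by simp
      also have "\<dots> \<longleftrightarrow> h c \<otimes>\<^bsub>H\<^esub> (?u \<otimes>\<^bsub>H\<^esub> y) \<in> A (cs c)"
        using cl y by (simp add: H.m_assoc flip: H.m_assoc[of "h c" "inv\<^bsub>H\<^esub> (h c)"])
      also have "\<dots> \<longleftrightarrow> ?u \<otimes>\<^bsub>H\<^esub> y \<in> A N"
        using rel1[OF abc(3), of "?u \<otimes>\<^bsub>H\<^esub> y"] cl y by simp
      finally show ?thesis by simp
    qed
    then have "?u \<in> L" using cl unfolding L_def by simp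
    then have "L #>\<^bsub>H\<^esub> ?u = \<one>\<^bsub>H Mod L\<^esub>" using L.rcos_const by simp
    then have "L #>\<^bsub>H\<^esub> (h c \<otimes>\<^bsub>H\<^esub> ?u) = L #>\<^bsub>H\<^esub> h c"
      using cl p.hom_mult[of "h c" ?u] Q.r_one[OF p.hom_closed[of "h c"]] by simp
    moreover have "h c \<otimes>\<^bsub>H\<^esub> ?u = h a \<otimes>\<^bsub>H\<^esub> h b" using cl by (simp flip: H.m_assoc)
    ultimately show "(L #>\<^bsub>H\<^esub> h a) \<otimes>\<^bsub>H Mod L\<^esub> (L #>\<^bsub>H\<^esub> h b) = L #>\<^bsub>H\<^esub> h c"
      using p.hom_mult cl by simp
  qed
  then obtain \<psi> where \<psi>: "\<psi> \<in> hom (G\<lparr>carrier := carrier G\<rparr>) (H Mod L)"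
    "\<forall>t\<in>T. \<psi> t = L #>\<^bsub>H\<^esub> h t" "\<forall>n\<in>N. \<psi> n = \<one>\<^bsub>H Mod L\<^esub>"
    using pT Q.is_group unfolding presents_def by blast
  have \<psi>h: "\<psi> \<in> hom G (H Mod L)" using \<psi>(1) unfolding hom_def by simp
  interpret \<psi>: group_hom G "H Mod L" \<psi>
    using \<psi>h by (simp add: group_hom_def group_hom_axioms_def G.is_group Q.is_group)

  have surj: "\<psi> ` carrier G = carrier (H Mod L)"
  proof
    have "subgroup {u \<in> carrier H. L #>\<^bsub>H\<^esub> u \<in> \<psi> ` carrier G} H"
      by (rule p.subgroup_preimage) (rule \<psi>.img_is_subgroup)
    moreover have "h ` T \<subseteq> {u \<in> carrier H. L #>\<^bsub>H\<^esub> u \<in> \<psi> ` carrier G}"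
    proof (intro subsetI, elim imageE)
      fix u t assume "u = h t" "t \<in> T"
      moreover have "L #>\<^bsub>H\<^esub> h t = \<psi> t" "t \<in> carrier G" using \<psi>(2) \<open>t \<in> T\<close> Tc by auto
      ultimately show "u \<in> {u \<in> carrier H. L #>\<^bsub>H\<^esub> u \<in> \<psi> ` carrier G}" using hT by auto
    qed
    ultimately have "generate H (h ` T) \<subseteq> {u \<in> carrier H. L #>\<^bsub>H\<^esub> u \<in> \<psi> ` carrier G}"
      by (intro H.generate_subgroup_incl)
    then show "carrier (H Mod L) \<subseteq> \<psi> ` carrier G"
      unfolding h(2) carrier_FactGroup by auto
  qed auto

  \<comment> \<open>The invariant of a word: every lift \<open>u\<close> of \<open>\<psi> x\<close>
    to \<open>H\<close> translates \<open>A N\<close> into \<open>A U\<close>. Quantifying over all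
    lifts allows the lift to change from letter to letter.\<close>
  have inv: "x \<in> carrier G \<and> U \<in> \<F> \<and>
      (\<forall>u\<in>carrier H. L #>\<^bsub>H\<^esub> u = \<psi> x \<longrightarrow> (\<forall>y\<in>A N. u \<otimes>\<^bsub>H\<^esub> y \<in> A U))"
    if "reach G N T \<F> x U" for x U
    using that
  proof (induction)
    case (start U)
    have "u \<otimes>\<^bsub>H\<^esub> y \<in> A U" if u: "u \<in> carrier H" "L #>\<^bsub>H\<^esub> u = \<psi> \<one>\<^bsub>G\<^esub>" and y: "y \<in> A N" for u y
    proof -
      have "u \<in> L" using u L.rcos_eq_self_iff by simp
      then have uy: "u \<otimes>\<^bsub>H\<^esub> y \<in> A N" using y A unfolding L_def by blast
      then obtain x where x: "\<forall>V\<in>\<V>. u \<otimes>\<^bsub>H\<^esub> y \<in> A V \<longleftrightarrow> x \<in> V"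
        using tr1[OF subsetD[OF A uy]] by blast
      then have "x \<in> N" using uy V(1) by simp
      then show ?thesis using x start V(2)[OF start(1)] by auto
    qed
    then show ?case using start by blast
  next
    case (mult x U s W)
    have xG: "x \<in> carrier G" and U: "U \<in> \<F>"
      and IH: "\<And>u y. \<lbrakk>u \<in> carrier H; L #>\<^bsub>H\<^esub> u = \<psi> x; y \<in> A N\<rbrakk> \<Longrightarrow> u \<otimes>\<^bsub>H\<^esub> y \<in> A U"
      using mult.IH by blast+
    have sG: "s \<in> carrier G" and sH: "h s \<in> carrier H" using mult.hyps Tc hT by auto
    have "u \<otimes>\<^bsub>H\<^esub> y \<in> A W" if u: "u \<in> carrier H" "L #>\<^bsub>H\<^esub> u = \<psi> (s \<otimes>\<^bsub>G\<^esub> x)" and y: "y \<in> A N" for u y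
    proof -
      have yH: "y \<in> carrier H" using y A by blast
      \<comment> \<open>Removing the letter \<open>h s\<close> leaves a lift of
        \<open>\<psi> x\<close>, to which the induction hypothesis applies. The inclusion
        \<open>s U \<subseteq> W\<close> is then used on a partner in \<open>G\<close>.\<close>
      let ?v = "inv\<^bsub>H\<^esub> (h s) \<otimes>\<^bsub>H\<^esub> u"
      have "L #>\<^bsub>H\<^esub> ?v = inv\<^bsub>H Mod L\<^esub> \<psi> s \<otimes>\<^bsub>H Mod L\<^esub> (\<psi> s \<otimes>\<^bsub>H Mod L\<^esub> \<psi> x)"
        using p.hom_mult[of "inv\<^bsub>H\<^esub> (h s)" u] p.hom_inv[OF sH] \<psi>(2) mult.hyps(2) sH u
          \<psi>.hom_mult[OF sG xG] by simp
      also have "\<dots> = \<psi> x"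
        using \<psi>.hom_closed sG xG by (metis Q.inv_solve_left' Q.m_closed)
      finally have z: "?v \<otimes>\<^bsub>H\<^esub> y \<in> A U" using IH[of ?v y] sH u y by simp
      then obtain x' where x': "?v \<otimes>\<^bsub>H\<^esub> y \<in> A U \<longleftrightarrow> x' \<in> U"
        "h s \<otimes>\<^bsub>H\<^esub> (?v \<otimes>\<^bsub>H\<^esub> y) \<in> A W \<longleftrightarrow> s \<otimes>\<^bsub>G\<^esub> x' \<in> W"
        using tr[OF subsetD[OF A z]] V(2)[OF U] V(2)[OF mult.hyps(3)] mult.hyps(2)
        by (elim bexE) simp
      have "h s \<otimes>\<^bsub>H\<^esub> (?v \<otimes>\<^bsub>H\<^esub> y) = u \<otimes>\<^bsub>H\<^esub> y" using sH u yH by (simp flip: H.m_assoc)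
      then show ?thesis using x' z mult.hyps(4) by simp
    qed
    then show ?case using mult.hyps xG sG by simp
  next
    case (mult_inv x U s W)
    have xG: "x \<in> carrier G" and U: "U \<in> \<F>"
      and IH: "\<And>u y. \<lbrakk>u \<in> carrier H; L #>\<^bsub>H\<^esub> u = \<psi> x; y \<in> A N\<rbrakk> \<Longrightarrow> u \<otimes>\<^bsub>H\<^esub> y \<in> A U"
      using mult_inv.IH by blast+
    have sG: "s \<in> carrier G" and sH: "h s \<in> carrier H" using mult_inv.hyps Tc hT by auto
    have "u \<otimes>\<^bsub>H\<^esub> y \<in> A W"
      if u: "u \<in> carrier H" "L #>\<^bsub>H\<^esub> u = \<psi> (inv\<^bsub>G\<^esub> s \<otimes>\<^bsub>G\<^esub> x)" and y: "y \<in> A N" for u y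
    proof -
      have yH: "y \<in> carrier H" using y A by blast
      \<comment> \<open>Configurations show translates by generators, not by their inverses. The
        partner is therefore taken for \<open>u \<otimes> y\<close>, and \<open>inv s\<close> is
        applied in \<open>G\<close>.\<close>
      let ?v = "h s \<otimes>\<^bsub>H\<^esub> u"
      have "L #>\<^bsub>H\<^esub> ?v = \<psi> s \<otimes>\<^bsub>H Mod L\<^esub> (inv\<^bsub>H Mod L\<^esub> \<psi> s \<otimes>\<^bsub>H Mod L\<^esub> \<psi> x)"
        using p.hom_mult[of "h s" u] \<psi>(2) mult_inv.hyps(2) sH u
          \<psi>.hom_mult[OF G.inv_closed[OF sG] xG] \<psi>.hom_inv[OF sG] by simp
      also have "\<dots> = \<psi> x"
        using \<psi>.hom_closed sG xG by (metis Q.inv_solve_left' Q.m_closed Q.inv_closed)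
      finally have z: "?v \<otimes>\<^bsub>H\<^esub> y \<in> A U" using IH[of ?v y] sH u y by simp
      have uy: "u \<otimes>\<^bsub>H\<^esub> y \<in> carrier H" using u yH by simp
      obtain x' where x': "x' \<in> carrier G" "u \<otimes>\<^bsub>H\<^esub> y \<in> A W \<longleftrightarrow> x' \<in> W"
        "h s \<otimes>\<^bsub>H\<^esub> (u \<otimes>\<^bsub>H\<^esub> y) \<in> A U \<longleftrightarrow> s \<otimes>\<^bsub>G\<^esub> x' \<in> U"
        using tr[OF uy] V(2)[OF U] V(2)[OF mult_inv.hyps(3)] mult_inv.hyps(2)
        by (elim bexE) simp
      have "s \<otimes>\<^bsub>G\<^esub> x' \<in> U" using x' z sH u yH by (simp add: H.m_assoc)
      then have "inv\<^bsub>G\<^esub> s \<otimes>\<^bsub>G\<^esub> (s \<otimes>\<^bsub>G\<^esub> x') \<in> W" by (rule mult_inv.hyps(4))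
      then show ?thesis using x' sG by (simp flip: G.m_assoc)
    qed
    then show ?case using mult_inv.hyps xG sG by simp
  next
    case (ker x U n)
    have "n \<in> carrier G" using ker N.mem_carrier by blast
    moreover have "\<psi> (n \<otimes>\<^bsub>G\<^esub> x) = \<psi> x"
      using \<psi>.hom_mult[OF \<open>n \<in> carrier G\<close>, of x] \<psi>(3) ker Q.l_one[of "\<psi> x"] \<psi>.hom_closed[of x]
      by simp
    ultimately show ?case using ker by simp
  qed

  have "kernel G (H Mod L) \<psi> = N"
  proof
    show "N \<subseteq> kernel G (H Mod L) \<psi>" using \<psi>(3) N.subset unfolding kernel_def by auto
    show "kernel G (H Mod L) \<psi> \<subseteq> N"
    proof (rule ccontr)
      assume "\<not> kernel G (H Mod L) \<psi> \<subseteq> N"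
      then obtain x where x: "x \<in> carrier G - N" "\<psi> x = L" unfolding kernel_def by auto
      obtain W where W: "reach G N T \<F> x W" "N \<inter> W = {}" using r[OF x(1)] by blast
      \<comment> \<open>The partner of the identity of \<open>G\<close> shows that
        \<open>A N\<close> is nonempty.\<close>
      obtain y where y: "y \<in> carrier H" "y \<in> A N"
        using tr'[OF G.one_closed] V(1) N.one_closed by (elim bexE) simp
      \<comment> \<open>Since \<open>\<psi> x\<close> is trivial, the identity of \<open>H\<close>
        is one of its lifts, so \<open>A N \<subseteq> A W\<close> by the invariant. A partner of
        \<open>y\<close> would then lie in \<open>N \<inter> W\<close>.\<close>
      have l1: "L #>\<^bsub>H\<^esub> \<one>\<^bsub>H\<^esub> = \<psi> x" using x H.coset_mult_one[OF LH] by simp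
      have WF: "W \<in> \<F>" using inv[OF W(1)] by simp
      have "\<forall>u\<in>carrier H. L #>\<^bsub>H\<^esub> u = \<psi> x \<longrightarrow> (\<forall>y\<in>A N. u \<otimes>\<^bsub>H\<^esub> y \<in> A W)"
        using inv[OF W(1)] by (elim conjE)
      then have "\<one>\<^bsub>H\<^esub> \<otimes>\<^bsub>H\<^esub> y \<in> A W" using l1 H.one_closed y(2) by metis
      then have "y \<in> A W" using y by simp
      moreover obtain x' where "\<forall>V\<in>\<V>. y \<in> A V \<longleftrightarrow> x' \<in> V" using tr1[OF y(1)] by blast
      ultimately show False using V(1) V(2)[OF WF] y(2) W(2) by auto
    qed
  qed
  then show ?thesis using that[OF \<open>L \<lhd> H\<close> \<psi>h surj] by blast
qed

text \<open>Lifting along \<open>\<psi>\<close> and reducing modulo \<open>M\<close> is a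
  homomorphism from \<open>H\<close> onto \<open>G Mod M\<close>, well defined because the kernel of
  \<open>\<psi>\<close> is inside \<open>M\<close>. Its kernel is \<open>J\<close>, and the first
  isomorphism theorem applies.\<close>

lemma quotient_correspondence:
  fixes G :: "('a, 'b) monoid_scheme" and H :: "('c, 'd) monoid_scheme"
  assumes G: "group G" and L: "L \<lhd> H" and \<psi>: "\<psi> \<in> hom G (H Mod L)"
    and surj: "\<psi> ` carrier G = carrier (H Mod L)"
    and ker: "kernel G (H Mod L) \<psi> \<subseteq> M" and M: "M \<lhd> G"
  defines "J \<equiv> {u \<in> carrier H. L #>\<^bsub>H\<^esub> u \<in> \<psi> ` M}"
  shows "J \<lhd> H" "G Mod M \<cong> H Mod J"
proof -
  interpret G: group G by fact
  interpret L: normal L H by fact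
  interpret M: normal M G by fact
  interpret Q: group "H Mod L" by (rule L.factorgroup_is_group)
  interpret p: group_hom H "H Mod L" "\<lambda>u. L #>\<^bsub>H\<^esub> u" by (rule L.FactGroup_group_hom)
  interpret \<psi>: group_hom G "H Mod L" \<psi>
    using \<psi> by (simp add: group_hom_def group_hom_axioms_def G.is_group Q.is_group)
  interpret m: group_hom G "G Mod M" "\<lambda>x. M #>\<^bsub>G\<^esub> x" by (rule M.FactGroup_group_hom)
  have coset: "M #>\<^bsub>G\<^esub> x = M #>\<^bsub>G\<^esub> y"
    if xy: "x \<in> carrier G" "y \<in> carrier G" "\<psi> x = \<psi> y" for x y
  proof -
    have "\<psi> (x \<otimes>\<^bsub>G\<^esub> inv\<^bsub>G\<^esub> y) = \<one>\<^bsub>H Mod L\<^esub>"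
      using xy \<psi>.hom_closed[OF xy(2)] by (simp del: mult_FactGroup one_FactGroup)
    then have "x \<otimes>\<^bsub>G\<^esub> inv\<^bsub>G\<^esub> y \<in> M" using ker xy unfolding kernel_def by auto
    then have "x \<in> M #>\<^bsub>G\<^esub> y" using M.rcos_module_rev[OF G.is_group] xy by blast
    then show ?thesis using G.repr_independence[OF _ xy(2) M.is_subgroup] by simp
  qed
  have "\<forall>u\<in>carrier H. \<exists>g. g \<in> carrier G \<and> \<psi> g = L #>\<^bsub>H\<^esub> u"
  proof
    fix u assume "u \<in> carrier H"
    then have "L #>\<^bsub>H\<^esub> u \<in> \<psi> ` carrier G" unfolding surj by (rule p.hom_closed)
    then show "\<exists>g. g \<in> carrier G \<and> \<psi> g = L #>\<^bsub>H\<^esub> u" by auto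
  qed
  then obtain \<sigma> where \<sigma>: "\<And>u. u \<in> carrier H \<Longrightarrow> \<sigma> u \<in> carrier G \<and> \<psi> (\<sigma> u) = L #>\<^bsub>H\<^esub> u"
    by metis
  define \<theta> where "\<theta> u = M #>\<^bsub>G\<^esub> \<sigma> u" for u
  have \<theta>: "\<theta> u = M #>\<^bsub>G\<^esub> g" if "u \<in> carrier H" "g \<in> carrier G" "\<psi> g = L #>\<^bsub>H\<^esub> u" for u g
    unfolding \<theta>_def by (rule coset) (use \<sigma>[OF that(1)] that in auto)
  have "\<theta> \<in> hom H (G Mod M)"
  proof (rule homI)
    show "\<theta> u \<in> carrier (G Mod M)" if "u \<in> carrier H" for u
      using \<sigma>[OF that] m.hom_closed unfolding \<theta>_def by blast
    fix u v assume uv: "u \<in> carrier H" "v \<in> carrier H"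
    have "\<psi> (\<sigma> u \<otimes>\<^bsub>G\<^esub> \<sigma> v) = L #>\<^bsub>H\<^esub> (u \<otimes>\<^bsub>H\<^esub> v)"
      using \<sigma>[OF uv(1)] \<sigma>[OF uv(2)] uv p.hom_mult[OF uv] by simp
    then have "\<theta> (u \<otimes>\<^bsub>H\<^esub> v) = M #>\<^bsub>G\<^esub> (\<sigma> u \<otimes>\<^bsub>G\<^esub> \<sigma> v)"
      using \<sigma>[OF uv(1)] \<sigma>[OF uv(2)] uv by (intro \<theta>) auto
    then show "\<theta> (u \<otimes>\<^bsub>H\<^esub> v) = \<theta> u \<otimes>\<^bsub>G Mod M\<^esub> \<theta> v"
      using m.hom_mult \<sigma> uv unfolding \<theta>_def by simp
  qed
  then interpret \<theta>: group_hom H "G Mod M" \<theta>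
    by (simp add: group_hom_def group_hom_axioms_def L.is_group M.factorgroup_is_group)
  have onto: "\<theta> ` carrier H = carrier (G Mod M)"
  proof
    show "carrier (G Mod M) \<subseteq> \<theta> ` carrier H"
    proof
      fix X assume "X \<in> carrier (G Mod M)"
      then obtain g where g: "g \<in> carrier G" "X = M #>\<^bsub>G\<^esub> g" by (auto simp: carrier_FactGroup)
      then obtain u where "u \<in> carrier H" "\<psi> g = L #>\<^bsub>H\<^esub> u"
        using \<psi>.hom_closed[OF g(1)] by (auto simp: carrier_FactGroup)
      then show "X \<in> \<theta> ` carrier H" using \<theta> g by blast
    qed
  qed auto
  have "kernel H (G Mod M) \<theta> = J"
  proof (intro equalityI subsetI)
    fix u assume "u \<in> kernel H (G Mod M) \<theta>"
    then have u: "u \<in> carrier H" "M #>\<^bsub>G\<^esub> \<sigma> u = M" unfolding kernel_def \<theta>_def by auto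
    then have "\<sigma> u \<in> M" using M.rcos_eq_self_iff \<sigma> by blast
    then show "u \<in> J" unfolding J_def using \<sigma>[OF u(1)] u(1) by auto
  next
    fix u assume "u \<in> J"
    then obtain n where n: "u \<in> carrier H" "n \<in> M" "\<psi> n = L #>\<^bsub>H\<^esub> u" unfolding J_def by auto
    then have "\<theta> u = M #>\<^bsub>G\<^esub> n" using \<theta> M.mem_carrier by blast
    then show "u \<in> kernel H (G Mod M) \<theta>"
      using n M.rcos_const[OF G.is_group] unfolding kernel_def by simp
  qed
  then show "J \<lhd> H" "G Mod M \<cong> H Mod J"
    using \<theta>.normal_kernel \<theta>.FactGroup_iso[OF onto] normal.factorgroup_is_group group.iso_sym
    by (metis, metis)
qed

text \<open>The members above \<open>N\<close> are carried through the shared quotient by the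
  correspondence theorem: \<open>\<Psi> M\<close> is the preimage in \<open>H\<close> of the image
  of \<open>M\<close> under \<open>\<psi>\<close>.\<close>

lemma polycyclic_quot_subgroups_embed:
  fixes G :: "('a, 'b) monoid_scheme" and H :: "('c, 'd) monoid_scheme"
  assumes fgG: "fin_gen_group G" and H: "group H" and Con: "Con_t G \<subseteq> Con_t H"
    and N: "N \<in> polycyclic_quot_subgroups G"
  obtains \<Psi> where "inj_on \<Psi> {M \<in> polycyclic_quot_subgroups G. N \<subseteq> M}"
    "\<Psi> ` {M \<in> polycyclic_quot_subgroups G. N \<subseteq> M} \<subseteq> polycyclic_quot_subgroups H"
    "\<forall>M\<in>{M \<in> polycyclic_quot_subgroups G. N \<subseteq> M}. \<forall>M'\<in>{M \<in> polycyclic_quot_subgroups G. N \<subseteq> M}.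
        \<Psi> (M \<inter> M') = \<Psi> M \<inter> \<Psi> M'"
    "\<forall>M\<in>{M \<in> polycyclic_quot_subgroups G. N \<subseteq> M}. G Mod M \<cong> H Mod \<Psi> M"
proof -
  interpret G: group G using fgG unfolding fin_gen_group_def by blast
  interpret H: group H by fact
  let ?P = "{M \<in> polycyclic_quot_subgroups G. N \<subseteq> M}"
  have "N \<lhd> G" "pc_series G N (carrier G)" using N G.polycyclic_quot_subgroups_iff by auto
  then obtain L \<psi> where L: "L \<lhd> H" and \<psi>: "\<psi> \<in> hom G (H Mod L)"
    and surj: "\<psi> ` carrier G = carrier (H Mod L)" and ker: "kernel G (H Mod L) \<psi> = N"
    by (rule pc_quotient_transfer[OF fgG H Con]) (rule that)
  interpret L: normal L H by fact
  interpret Q: group "H Mod L" by (rule L.factorgroup_is_group)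
  interpret \<psi>: group_hom G "H Mod L" \<psi>
    using \<psi> by (simp add: group_hom_def group_hom_axioms_def G.is_group Q.is_group)
  define \<Psi> where "\<Psi> M = {u \<in> carrier H. L #>\<^bsub>H\<^esub> u \<in> \<psi> ` M}" for M
  have P: "M \<lhd> G" "N \<subseteq> M" "M \<subseteq> carrier G" if "M \<in> ?P" for M
    using that subgroup.subset[OF normal_imp_subgroup, of M G]
    unfolding polycyclic_quot_subgroups_def by auto
  \<comment> \<open>\<open>M\<close> contains the kernel of \<open>\<psi>\<close>, so it is a union
    of fibres. This yields injectivity and makes images commute with intersections.\<close>
  have sat: "x \<in> M" if M: "M \<in> ?P" and x: "x \<in> carrier G" "y \<in> M" "\<psi> x = \<psi> y" for M x y
  proof -
    interpret M: normal M G using P M by blast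
    have y: "y \<in> carrier G" using x by simp
    have "\<psi> (x \<otimes>\<^bsub>G\<^esub> inv\<^bsub>G\<^esub> y) = \<one>\<^bsub>H Mod L\<^esub>"
      using x y \<psi>.hom_closed[OF y] by (simp del: mult_FactGroup one_FactGroup)
    then have "x \<otimes>\<^bsub>G\<^esub> inv\<^bsub>G\<^esub> y \<in> M" using ker P(2)[OF M] x y unfolding kernel_def by auto
    then have "x \<otimes>\<^bsub>G\<^esub> inv\<^bsub>G\<^esub> y \<otimes>\<^bsub>G\<^esub> y \<in> M" using x(2) by (rule M.m_closed)
    then show ?thesis using x(1) y by (simp add: G.m_assoc)
  qed
  have iso: "\<Psi> M \<lhd> H" "G Mod M \<cong> H Mod \<Psi> M" if "M \<in> ?P" for M
    using quotient_correspondence[OF G.is_group L \<psi> surj, of M] ker P[OF that] unfolding \<Psi>_def by auto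
  show ?thesis
  proof (rule that[of \<Psi>])
    show "inj_on \<Psi> ?P"
    proof (rule inj_onI)
      have sub: "M \<subseteq> M'" if M: "M \<in> ?P" "M' \<in> ?P" and eq: "\<Psi> M = \<Psi> M'" for M M'
      proof
        fix x assume x: "x \<in> M"
        then have xG: "x \<in> carrier G" using P M by blast
        then obtain u where u: "u \<in> carrier H" "\<psi> x = L #>\<^bsub>H\<^esub> u"
          using \<psi>.hom_closed[OF xG] by (auto simp: carrier_FactGroup)
        then have "u \<in> \<Psi> M'" using x eq[symmetric] unfolding \<Psi>_def by auto
        then obtain y where "y \<in> M'" "\<psi> x = \<psi> y" using u unfolding \<Psi>_def by auto
        then show "x \<in> M'" using sat[OF M(2) xG] by blast
      qed
      show "M = M'" if "M \<in> ?P" "M' \<in> ?P" "\<Psi> M = \<Psi> M'" for M M'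
        using sub[of M M'] sub[of M' M] that by auto
    qed
    show "\<Psi> ` ?P \<subseteq> polycyclic_quot_subgroups H"
    proof
      fix K assume "K \<in> \<Psi> ` ?P"
      then obtain M where M: "M \<in> ?P" "K = \<Psi> M" by blast
      have "polycyclic (G Mod M)" using M(1) unfolding polycyclic_quot_subgroups_def by blast
      then have "polycyclic (H Mod \<Psi> M)"
        using polycyclic_iso iso[OF M(1)] normal.factorgroup_is_group by blast
      then show "K \<in> polycyclic_quot_subgroups H"
        using iso(1)[OF M(1)] M(2) unfolding polycyclic_quot_subgroups_def by blast
    qed
    show "\<forall>M\<in>?P. \<forall>M'\<in>?P. \<Psi> (M \<inter> M') = \<Psi> M \<inter> \<Psi> M'"
    proof (intro ballI)
      fix M M' assume M: "M \<in> ?P" "M' \<in> ?P"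
      have "\<psi> ` M \<inter> \<psi> ` M' \<subseteq> \<psi> ` (M \<inter> M')"
      proof
        fix X assume "X \<in> \<psi> ` M \<inter> \<psi> ` M'"
        then obtain x y where x: "x \<in> M" "X = \<psi> x" "y \<in> M'" "X = \<psi> y" by blast
        then have "x \<in> M'" using sat[OF M(2), of x y] P(3)[OF M(1)] by auto
        then show "X \<in> \<psi> ` (M \<inter> M')" using x by blast
      qed
      then show "\<Psi> (M \<inter> M') = \<Psi> M \<inter> \<Psi> M'" unfolding \<Psi>_def by blast
    qed
    show "\<forall>M\<in>?P. G Mod M \<cong> H Mod \<Psi> M" using iso(2) by blast
  qed
qed

subsection \<open>Comparison of the two collections\<close>

lemma (in group) Inter_polycyclic_quot_subgroups:
  assumes "finite K" "K \<noteq> {}" "K \<subseteq> polycyclic_quot_subgroups G"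
  shows "\<Inter> K \<in> polycyclic_quot_subgroups G"
  using assms
  by (induction rule: finite_ne_induct) (simp_all add: polycyclic_quot_subgroups_Int)

text \<open>A finite nonempty subfamily lies above its own intersection, which is again a member, so
  it embeds into the collection of \<open>H\<close>. Bounding all finite subfamilies bounds the
  whole collection.\<close>

lemma card_polycyclic_quot_subgroups_le:
  assumes fgG: "fin_gen_group G" and H: "group H" and Con: "Con_t G \<subseteq> Con_t H"
    and fin: "finite (polycyclic_quot_subgroups H)"
  shows "finite (polycyclic_quot_subgroups G) \<and>
    card (polycyclic_quot_subgroups G) \<le> card (polycyclic_quot_subgroups H)"
proof (rule finite_if_finite_subsets_card_bdd)
  interpret G: group G using fgG unfolding fin_gen_group_def by blast
  fix K assume K: "K \<subseteq> polycyclic_quot_subgroups G" "finite K"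
  show "card K \<le> card (polycyclic_quot_subgroups H)"
  proof (cases "K = {}")
    case False
    then have "\<Inter> K \<in> polycyclic_quot_subgroups G"
      using G.Inter_polycyclic_quot_subgroups K by blast
    then obtain \<Psi> where \<Psi>: "inj_on \<Psi> {M \<in> polycyclic_quot_subgroups G. \<Inter> K \<subseteq> M}"
      "\<Psi> ` {M \<in> polycyclic_quot_subgroups G. \<Inter> K \<subseteq> M} \<subseteq> polycyclic_quot_subgroups H"
      by (rule polycyclic_quot_subgroups_embed[OF fgG H Con]) (rule that)
    have "K \<subseteq> {M \<in> polycyclic_quot_subgroups G. \<Inter> K \<subseteq> M}" using K by blast
    then show ?thesis
      using inj_on_subset[OF \<Psi>(1)] order_trans[OF image_mono \<Psi>(2)] fin by (intro card_inj_on_le[of \<Psi>])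
  qed simp
qed

section \<open>Countability of the collections\<close>

lemma (in group) countable_generate:
  assumes "X \<subseteq> carrier G" "countable X"
  shows "countable (generate G X)"
proof -
  let ?Y = "X \<union> m_inv G ` X"
  let ?f = "\<lambda>xs. foldr (\<otimes>) xs \<one>"
  have fc: "?f xs \<in> carrier G" if "xs \<in> lists ?Y" for xs
    using that assms(1) by (induction xs) auto
  have app: "?f (xs @ ys) = ?f xs \<otimes> ?f ys" if "xs \<in> lists ?Y" "ys \<in> lists ?Y" for xs ys
    using that(1)
  proof (induction xs)
    case Nil
    then show ?case using fc[OF that(2)] by simp
  next
    case (Cons x xs)
    then have "x \<in> carrier G" "?f xs \<in> carrier G" using assms(1) fc by auto
    then show ?case using Cons fc[OF that(2)] by (simp add: m_assoc)
  qed
  have "z \<in> ?f ` lists ?Y" if "z \<in> generate G X" for z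
    using that
  proof (induction)
    case one
    then show ?case by (intro image_eqI[of _ _ "[]"]) auto
  next
    case (incl x)
    then show ?case using assms by (intro image_eqI[of _ _ "[x]"]) auto
  next
    case (inv x)
    then show ?case using assms by (intro image_eqI[of _ _ "[inv x]"]) auto
  next
    case (eng x y)
    then obtain xs ys where "xs \<in> lists ?Y" "x = ?f xs" "ys \<in> lists ?Y" "y = ?f ys" by blast
    then show ?case using app[of xs ys] by (intro image_eqI[of _ _ "xs @ ys"]) auto
  qed
  then have "generate G X \<subseteq> ?f ` lists ?Y" by blast
  moreover have "countable (?f ` lists ?Y)"
    using assms(2) by (intro countable_image countable_lists) auto
  ultimately show ?thesis using countable_subset by blast
qed

text \<open>Finite presentability makes each member recoverable from finitely many elements, and a
  finitely generated group has only countably many finite subsets.\<close>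

lemma countable_polycyclic_quot_subgroups:
  fixes G :: "('a, 'b) monoid_scheme" (structure)
  assumes "fin_gen_group G"
  shows "countable (polycyclic_quot_subgroups G)"
proof -
  interpret group G using assms unfolding fin_gen_group_def by blast
  obtain X where X: "finite X" "X \<subseteq> carrier G" "generate G X = carrier G"
    using assms unfolding fin_gen_group_def by blast
  have cG: "countable (carrier G)" using countable_generate[of X] X countable_finite by auto
  define cl where "cl D = \<Inter> {M. M \<lhd> G \<and> D \<subseteq> M}" for D
  have "N \<in> cl ` {D. finite D \<and> D \<subseteq> carrier G}" if NP: "N \<in> polycyclic_quot_subgroups G" for N
  proof -
    have NG: "N \<lhd> G" and pc: "pc_series G N (carrier G)"
      using NP polycyclic_quot_subgroups_iff by auto
    interpret N: normal N G by fact
    obtain S0 where S0: "presents TYPE('a set) G N (carrier G) S0"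
      using pc_series_presents[OF NG pc] by blast
    obtain T where T: "X \<subseteq> T" and pT: "presents TYPE('a set) G N (carrier G) T"
      using presents_extend[OF X(1,2) S0] by blast
    have Tc: "finite T" "T \<subseteq> carrier G" using pT unfolding presents_def by blast+
    \<comment> \<open>\<open>N\<close> is the normal closure of the finitely many relators in \<open>D\<close>.\<close>
    define D where "D = (\<lambda>(a, b, c). a \<otimes> b \<otimes> inv c) ` (T \<times> T \<times> T) \<inter> N"
    \<comment> \<open>As \<open>D\<close> lies in \<open>M\<close>, the projection to
      \<open>G Mod M\<close> respects the table of \<open>T\<close> modulo \<open>N\<close>. The
      homomorphism obtained from the presentation agrees with the projection on \<open>X\<close>,
      hence everywhere, and it kills \<open>N\<close>.\<close>
    have "N \<subseteq> M" if M: "M \<lhd> G" "D \<subseteq> M" for M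
    proof -
      interpret M: normal M G by fact
      interpret m: group_hom G "G Mod M" "\<lambda>x. M #> x" by (rule M.FactGroup_group_hom)
      have "partial_hom G N T (G Mod M) (\<lambda>x. M #> x)"
        unfolding partial_hom_def
      proof (intro conjI ballI impI)
        show "(\<lambda>x. M #> x) \<in> T \<rightarrow> carrier (G Mod M)" using Tc m.hom_closed by blast
        fix a b c assume abc: "a \<in> T" "b \<in> T" "c \<in> T" "a \<otimes> b \<otimes> inv c \<in> N"
        then have "a \<otimes> b \<otimes> inv c \<in> (\<lambda>(a, b, c). a \<otimes> b \<otimes> inv c) ` (T \<times> T \<times> T)"
          by (intro image_eqI[of _ _ "(a, b, c)"]) auto
        then have "a \<otimes> b \<otimes> inv c \<in> M" using abc M(2) unfolding D_def by blast
        moreover have G: "a \<in> carrier G" "b \<in> carrier G" "c \<in> carrier G" using abc Tc by auto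
        ultimately have "a \<otimes> b \<in> M #> c" using M.rcos_module_rev[OF is_group] by simp
        then have "M #> c = M #> (a \<otimes> b)" using repr_independence[OF _ _ M.is_subgroup] G by blast
        then show "(M #> a) \<otimes>\<^bsub>G Mod M\<^esub> (M #> b) = M #> c" using m.hom_mult G by simp
      qed
      then obtain \<psi> where \<psi>: "\<psi> \<in> hom (G\<lparr>carrier := carrier G\<rparr>) (G Mod M)"
        "\<forall>t\<in>T. \<psi> t = M #> t" "\<forall>n\<in>N. \<psi> n = \<one>\<^bsub>G Mod M\<^esub>"
        using pT M.factorgroup_is_group unfolding presents_def by blast
      have \<psi>h: "\<psi> \<in> hom G (G Mod M)" using \<psi>(1) unfolding hom_def by simp
      interpret \<psi>: group_hom G "G Mod M" \<psi>
        using \<psi>h by (simp add: group_hom_def group_hom_axioms_def is_group M.factorgroup_is_group)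
      have "\<psi> x = M #> x" if "x \<in> generate G X" for x
        using that
      proof (induction)
        case one
        then show ?case using \<psi>.hom_one m.hom_one by simp
      next
        case (incl x)
        then show ?case using \<psi>(2) T by blast
      next
        case (inv x)
        then have "x \<in> carrier G" "\<psi> x = M #> x" using X \<psi>(2) T by auto
        then show ?case using \<psi>.hom_inv m.hom_inv by simp
      next
        case (eng x y)
        then have "x \<in> carrier G" "y \<in> carrier G" using X by auto
        then show ?case using \<psi>.hom_mult m.hom_mult eng.IH by simp
      qed
      then show "N \<subseteq> M"
        using \<psi>(3) X(3) M.rcos_eq_self_iff N.subset by (metis one_FactGroup subsetD subsetI)
    qed
    moreover have "D \<subseteq> N" unfolding D_def by blast
    ultimately have "N = cl D" using NG unfolding cl_def by blast
    moreover have "finite D" "D \<subseteq> carrier G" using Tc N.subset unfolding D_def by auto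
    ultimately show ?thesis by blast
  qed
  then have "polycyclic_quot_subgroups G \<subseteq> cl ` {D. finite D \<and> D \<subseteq> carrier G}" by blast
  moreover have "countable (cl ` {D. finite D \<and> D \<subseteq> carrier G})"
    by (intro countable_image countable_Collect_finite_subset cG)
  ultimately show ?thesis by (rule countable_subset)
qed

lemma countable_infinite_eqpoll:
  assumes "countable A" "infinite A" "countable B" "infinite B"
  shows "A \<approx> B"
proof -
  have "A \<approx> (UNIV :: nat set)" "B \<approx> (UNIV :: nat set)"
    using assms to_nat_on_infinite unfolding eqpoll_def by blast+
  then show ?thesis using eqpoll_sym eqpoll_trans by blast
qed

theorem corollary3p8:
  fixes G :: "('a, 'b) monoid_scheme" and H :: "('c, 'd) monoid_scheme"
  assumes "fin_gen_group G" and "fin_gen_group H"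
    and "Con_t G = Con_t H"
  shows "polycyclic_quot_subgroups G \<approx> polycyclic_quot_subgroups H \<and>
    (finite (polycyclic_quot_subgroups G) \<longrightarrow>
      (\<exists>\<Psi>. bij_betw \<Psi> (polycyclic_quot_subgroups G) (polycyclic_quot_subgroups H) \<and>
        (\<forall>N \<in> polycyclic_quot_subgroups G. \<forall>M \<in> polycyclic_quot_subgroups G.
            \<Psi> (N \<inter> M) = \<Psi> N \<inter> \<Psi> M) \<and>
        (\<forall>N \<in> polycyclic_quot_subgroups G. G Mod N \<cong> H Mod \<Psi> N)))"
proof -
  let ?P = "polycyclic_quot_subgroups G" and ?R = "polycyclic_quot_subgroups H"
  interpret G: group G using assms(1) unfolding fin_gen_group_def by blast
  interpret H: group H using assms(2) unfolding fin_gen_group_def by blast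
  have le: "finite ?R \<Longrightarrow> finite ?P \<and> card ?P \<le> card ?R"
    using card_polycyclic_quot_subgroups_le[OF assms(1) H.is_group] assms(3) by simp
  have ge: "finite ?P \<Longrightarrow> finite ?R \<and> card ?R \<le> card ?P"
    using card_polycyclic_quot_subgroups_le[OF assms(2) G.is_group] assms(3) by simp
  show ?thesis
  proof (cases "finite ?P")
    case True
    have "?P \<noteq> {}" using G.carrier_in_polycyclic_quot_subgroups by blast
    \<comment> \<open>A finite collection contains its own intersection. Every member lies above it,
      so one embedding covers the whole collection.\<close>
    then have "\<Inter> ?P \<in> ?P" using G.Inter_polycyclic_quot_subgroups[OF True] by blast
    then obtain \<Psi> where \<Psi>: "inj_on \<Psi> {M \<in> ?P. \<Inter> ?P \<subseteq> M}" "\<Psi> ` {M \<in> ?P. \<Inter> ?P \<subseteq> M} \<subseteq> ?R"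
      "\<forall>M\<in>{M \<in> ?P. \<Inter> ?P \<subseteq> M}. \<forall>M'\<in>{M \<in> ?P. \<Inter> ?P \<subseteq> M}. \<Psi> (M \<inter> M') = \<Psi> M \<inter> \<Psi> M'"
      "\<forall>M\<in>{M \<in> ?P. \<Inter> ?P \<subseteq> M}. G Mod M \<cong> H Mod \<Psi> M"
      by (rule polycyclic_quot_subgroups_embed[OF assms(1) H.is_group equalityD1[OF assms(3)]]) (rule that)
    moreover have all: "{M \<in> ?P. \<Inter> ?P \<subseteq> M} = ?P" by blast
    ultimately have \<Psi>: "inj_on \<Psi> ?P" "\<Psi> ` ?P \<subseteq> ?R"
      "\<forall>M\<in>?P. \<forall>M'\<in>?P. \<Psi> (M \<inter> M') = \<Psi> M \<inter> \<Psi> M'" "\<forall>M\<in>?P. G Mod M \<cong> H Mod \<Psi> M"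
      unfolding all by - assumption+
    \<comment> \<open>The bounds in both directions give equal finite cardinalities, so the
      injection is onto.\<close>
    have "card (\<Psi> ` ?P) = card ?R" using le ge True card_image[OF \<Psi>(1)] by simp
    then have "\<Psi> ` ?P = ?R" using card_subset_eq ge[OF True] \<Psi>(2) by blast
    then have "bij_betw \<Psi> ?P ?R" using \<Psi>(1) unfolding bij_betw_def by blast
    then show ?thesis using \<Psi>(3,4) unfolding eqpoll_def by blast
  next
    case False
    then have "infinite ?R" using le by blast
    then show ?thesis
      using False countable_infinite_eqpoll[OF countable_polycyclic_quot_subgroups[OF assms(1)] _
          countable_polycyclic_quot_subgroups[OF assms(2)]] by simp
  qed
qed

end
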